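(* Let $n \ge 1$ and let $r(z,\bar z)=\sum_{|\alpha|=|\beta|=m} c_{\alpha,\beta} z^\alpha \bar z^\beta$ be a real bihomogeneous polynomial on the diagonal of $\mathbb{C}^n\times\mathbb{C}^n$ of bi-degree $(m,m)$ whose coefficient matrix $(c_{\alpha,\beta})$ has signature $(P,1)$. Suppose that $r(z,\bar z)\,\|z\|^2$ is a squared norm, where $\|z\|^2=\sum_{j=1}^n |z_j|^2$. If $n\le 3$, then $P\ge n$. However, if $n\ge 4$, then there exist such $r$ (signature $(P,1)$, with $r(z,\bar z)\|z\|^2$ a squared norm) with $P<n$.
   Context: A polynomial $r(z,\bar z)=\sum c_{\alpha,\beta}z^\alpha\bar z^\beta$ is real if its coefficient matrix $(c_{\alpha,\beta})$ is Hermitian; it is bihomogeneous of bi-degree $(m,m)$ if all terms have $|\alpha|=|\beta|=m$. Its signature $(P,N)$ is the signature of the Hermitian matrix $(c_{\alpha,\beta})$, i.e. $P$ is the number of positive and $N$ the number of negative eigenvalues. A real polynomial $s(z,\bar z)$ is a squared norm if $s(z,\bar z)=\|h(z)\|^2=\sum_{k=1}^{\rho}|h_k(z)|^2$ for some holomorphic polynomial mapping $h=(h_1,\dots,h_\rho)$ on $\mathbb{C}^n$. *)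

theory Defs
  imports Complex_Main "Jordan_Normal_Form.Char_Poly"
begin

text \<open>Multi-indices in n variables are lists of length n of natural numbers.
  mis n m lists (without repetition) all multi-indices alpha with |alpha| = m.\<close>
fun mis :: "nat \<Rightarrow> nat \<Rightarrow> nat list list" where
  "mis 0 m = (if m = 0 then [[]] else [])"
| "mis (Suc n) m = concat (map (\<lambda>k. map (\<lambda>l. k # l) (mis n (m - k))) [0..<Suc m])"

text \<open>Monomial z^alpha for z in C^n (coordinates z 0, ..., z (n-1)).\<close>
definition mono :: "(nat \<Rightarrow> complex) \<Rightarrow> nat list \<Rightarrow> complex" where
  "mono z \<alpha> = (\<Prod>j<length \<alpha>. z j ^ (\<alpha> ! j))"

definition bihom :: "nat \<Rightarrow> nat \<Rightarrow> (nat list \<Rightarrow> nat list \<Rightarrow> complex) \<Rightarrow> (nat \<Rightarrow> complex) \<Rightarrow> complex" where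
  "bihom n m c z = (\<Sum>\<alpha>\<in>set (mis n m). \<Sum>\<beta>\<in>set (mis n m). c \<alpha> \<beta> * mono z \<alpha> * cnj (mono z \<beta>))"

text \<open>Real: the coefficient matrix is Hermitian.\<close>
definition hermitian_coeffs :: "nat \<Rightarrow> nat \<Rightarrow> (nat list \<Rightarrow> nat list \<Rightarrow> complex) \<Rightarrow> bool" where
  "hermitian_coeffs n m c \<longleftrightarrow> (\<forall>\<alpha>\<in>set (mis n m). \<forall>\<beta>\<in>set (mis n m). c \<alpha> \<beta> = cnj (c \<beta> \<alpha>))"

definition coeff_mat :: "nat \<Rightarrow> nat \<Rightarrow> (nat list \<Rightarrow> nat list \<Rightarrow> complex) \<Rightarrow> complex mat" where
  "coeff_mat n m c = mat (length (mis n m)) (length (mis n m))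
      (\<lambda>(i, j). c (mis n m ! i) (mis n m ! j))"

definition num_pos_eig :: "complex mat \<Rightarrow> nat" where
  "num_pos_eig A = (\<Sum>x\<in>{x. Im x = 0 \<and> Re x > 0 \<and> poly (char_poly A) x = 0}. order x (char_poly A))"

definition num_neg_eig :: "complex mat \<Rightarrow> nat" where
  "num_neg_eig A = (\<Sum>x\<in>{x. Im x = 0 \<and> Re x < 0 \<and> poly (char_poly A) x = 0}. order x (char_poly A))"

definition signature :: "nat \<Rightarrow> nat \<Rightarrow> (nat list \<Rightarrow> nat list \<Rightarrow> complex) \<Rightarrow> nat \<times> nat" where
  "signature n m c = (num_pos_eig (coeff_mat n m c), num_neg_eig (coeff_mat n m c))"

definition holo_poly :: "nat \<Rightarrow> ((nat \<Rightarrow> complex) \<Rightarrow> complex) \<Rightarrow> bool" where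
  "holo_poly n f \<longleftrightarrow> (\<exists>S a. finite S \<and> (\<forall>\<alpha>\<in>S. length \<alpha> = n) \<and>
      (\<forall>z. f z = (\<Sum>\<alpha>\<in>S. a \<alpha> * mono z \<alpha>)))"

definition squared_norm :: "nat \<Rightarrow> ((nat \<Rightarrow> complex) \<Rightarrow> complex) \<Rightarrow> bool" where
  "squared_norm n s \<longleftrightarrow> (\<exists>(\<rho>::nat) h. (\<forall>k<\<rho>. holo_poly n (h k)) \<and>
      (\<forall>z. s z = complex_of_real (\<Sum>k<\<rho>. (cmod (h k z))\<^sup>2)))"

definition normsq :: "nat \<Rightarrow> (nat \<Rightarrow> complex) \<Rightarrow> complex" where
  "normsq n z = complex_of_real (\<Sum>j<n. (cmod (z j))\<^sup>2)"

end

theory Submission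
  imports Defs "Jordan_Normal_Form.Spectral_Radius" "Jordan_Normal_Form.Schur_Decomposition"
begin

text \<open>Diagonalizing the coefficient matrix writes \<open>r = \<Sum>\<^sub>k d\<^sub>k |F\<^sub>k|\<^sup>2\<close> with linearly independent \<open>F\<^sub>k\<close>, exactly one
  \<open>d\<^sub>q\<close> being negative. If \<open>r \<parallel>z\<parallel>\<^sup>2\<close> is a squared norm, polarization shows that every \<open>z\<^sub>j F\<^sub>q\<close> is a linear
  combination of the products \<open>z\<^sub>l F\<^sub>k\<close> with \<open>d\<^sub>k > 0\<close>, i.e. \<open>z F\<^sub>q = \<Sum>\<^sub>k F\<^sub>k A\<^sub>k z\<close> for constant matrices
  \<open>A\<^sub>k\<close>. For at most \<open>n - 1 \<le> 2\<close> positive terms, left eigenvectors of the \<open>A\<^sub>k\<close> force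
  \<open>F\<^sub>q\<close> into the span of these \<open>F\<^sub>k\<close>, a contradiction.

  In four variables the quadrics \<open>z\<^sub>1 z\<^sub>2\<close>, \<open>z\<^sub>2 z\<^sub>3\<close>, \<open>z\<^sub>3 z\<^sub>4\<close>, \<open>z\<^sub>4 z\<^sub>1\<close> satisfy the relation
  \<open>z\<^sub>3 z\<^sub>4 S\<^sub>1\<^sub>2 z + z\<^sub>1 z\<^sub>4 S\<^sub>2\<^sub>3 z + z\<^sub>1 z\<^sub>2 S\<^sub>3\<^sub>4 z + z\<^sub>2 z\<^sub>3 S\<^sub>4\<^sub>1 z = 0\<close> over elementary skew matrices
  \<open>S\<^sub>i\<^sub>j\<close>. As \<open>S\<^sub>1\<^sub>2 + S\<^sub>3\<^sub>4\<close> is invertible, each \<open>z\<^sub>j z\<^sub>3 z\<^sub>4\<close> lies in the span of the products of the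
  variables with only three quadrics \<open>z\<^sub>1 z\<^sub>2 - z\<^sub>3 z\<^sub>4\<close>, \<open>z\<^sub>1 z\<^sub>4\<close>, \<open>z\<^sub>2 z\<^sub>3\<close>. Each further variable
  \<open>z\<^sub>j\<close> costs one more quadric, \<open>z\<^sub>3 z\<^sub>j\<close>.\<close>

section \<open>Functions that are polynomial along lines\<close>

text \<open>Restrictions to complex lines suffice for cancellation and polarization, since a
  one-variable polynomial with infinitely many zeros is zero. The index type is arbitrary so that
  variables can be doubled to \<open>'i + 'i\<close>.\<close>

definition polyfun :: "(('i \<Rightarrow> complex) \<Rightarrow> complex) \<Rightarrow> bool" where
  "polyfun F \<longleftrightarrow> (\<forall>p v. \<exists>P. \<forall>t. F (\<lambda>i. p i + t * v i) = poly P t)"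

lemma polyfun_const [intro]: "polyfun (\<lambda>z. c)"
  unfolding polyfun_def by (intro allI exI[of _ "[:c:]"]) simp

lemma polyfun_coord [intro]: "polyfun (\<lambda>z. z i)"
  unfolding polyfun_def
proof (intro allI)
  fix p v :: "'a \<Rightarrow> complex"
  show "\<exists>P. \<forall>t. p i + t * v i = poly P t"
    by (rule exI[of _ "[:p i, v i:]"]) simp
qed

lemma polyfun_lineE:
  assumes "polyfun F"
  obtains P where "\<And>t. F (\<lambda>i. p i + t * v i) = poly P t"
  using assms unfolding polyfun_def by metis

lemma polyfunI:
  assumes "\<And>p v. \<exists>P. \<forall>t. F (\<lambda>i. p i + t * v i) = poly P t"
  shows "polyfun F"
  unfolding polyfun_def using assms by auto

lemma polyfun_add [intro]:
  assumes "polyfun F" "polyfun G"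
  shows "polyfun (\<lambda>z. F z + G z)"
proof (rule polyfunI)
  fix p v
  obtain P where "\<And>t. F (\<lambda>i. p i + t * v i) = poly P t" by (rule polyfun_lineE[OF assms(1), of p v]) (rule that)
  moreover obtain Q where "\<And>t. G (\<lambda>i. p i + t * v i) = poly Q t" by (rule polyfun_lineE[OF assms(2), of p v]) (rule that)
  ultimately show "\<exists>R. \<forall>t. F (\<lambda>i. p i + t * v i) + G (\<lambda>i. p i + t * v i) = poly R t"
    by (intro exI[of _ "P + Q"]) simp
qed

lemma polyfun_mult [intro]:
  assumes "polyfun F" "polyfun G"
  shows "polyfun (\<lambda>z. F z * G z)"
proof (rule polyfunI)
  fix p v
  obtain P where "\<And>t. F (\<lambda>i. p i + t * v i) = poly P t" by (rule polyfun_lineE[OF assms(1), of p v]) (rule that)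
  moreover obtain Q where "\<And>t. G (\<lambda>i. p i + t * v i) = poly Q t" by (rule polyfun_lineE[OF assms(2), of p v]) (rule that)
  ultimately show "\<exists>R. \<forall>t. F (\<lambda>i. p i + t * v i) * G (\<lambda>i. p i + t * v i) = poly R t"
    by (intro exI[of _ "P * Q"]) simp
qed

lemma polyfun_diff [intro]:
  assumes "polyfun F" "polyfun G"
  shows "polyfun (\<lambda>z. F z - G z)"
  using polyfun_add[OF assms(1) polyfun_mult[OF polyfun_const[of "-1"] assms(2)]] by simp

lemma polyfun_power [intro]: "polyfun F \<Longrightarrow> polyfun (\<lambda>z. F z ^ k)"
  by (induction k) (simp_all add: polyfun_const polyfun_mult)

lemma polyfun_sum [intro]: "(\<And>i. i \<in> I \<Longrightarrow> polyfun (F i)) \<Longrightarrow> polyfun (\<lambda>z. \<Sum>i\<in>I. F i z)"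
  by (induction I rule: infinite_finite_induct) (simp_all add: polyfun_const polyfun_add)

lemma polyfun_prod [intro]: "(\<And>i. i \<in> I \<Longrightarrow> polyfun (F i)) \<Longrightarrow> polyfun (\<lambda>z. \<Prod>i\<in>I. F i z)"
  by (induction I rule: infinite_finite_induct) (simp_all add: polyfun_const polyfun_mult)

lemma polyfun_reindex: "polyfun F \<Longrightarrow> polyfun (\<lambda>z. F (\<lambda>i. z (f i)))"
  unfolding polyfun_def
proof (intro allI)
  fix p v :: "'b \<Rightarrow> complex"
  assume "\<forall>p v. \<exists>P. \<forall>t. F (\<lambda>i. p i + t * v i) = poly P t"
  from this[rule_format, of "\<lambda>i. p (f i)" "\<lambda>i. v (f i)"]
  show "\<exists>P. \<forall>t. F (\<lambda>i. p (f i) + t * v (f i)) = poly P t" .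
qed

text \<open>Conjugating both argument and value conjugates the coefficients, so the result is again
  polynomial in \<open>z\<close>. Antiholomorphic factors take this form after polarization.\<close>

lemma polyfun_cnj:
  assumes "polyfun F"
  shows "polyfun (\<lambda>z. cnj (F (\<lambda>i. cnj (z i))))"
  unfolding polyfun_def
proof (intro allI)
  fix p v :: "'a \<Rightarrow> complex"
  obtain P where P: "\<And>t. F (\<lambda>i. cnj (p i) + t * cnj (v i)) = poly P t"
    by (rule polyfun_lineE[OF assms, of "\<lambda>i. cnj (p i)" "\<lambda>i. cnj (v i)"]) (rule that)
  have "cnj (F (\<lambda>i. cnj (p i + t * v i))) = poly (map_poly cnj P) t" for t
    using P[of "cnj t"] by simp
  then show "\<exists>P. \<forall>t. cnj (F (\<lambda>i. cnj (p i + t * v i))) = poly P t" by blast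
qed

lemma polyfun_mono [intro]: "polyfun (\<lambda>z. mono z \<alpha>)"
  unfolding mono_def by (intro polyfun_prod polyfun_power polyfun_coord)

lemma polyfun_holo_poly:
  assumes "holo_poly n f"
  shows "polyfun f"
proof -
  obtain S a where "\<And>z. f z = (\<Sum>\<alpha>\<in>S. a \<alpha> * mono z \<alpha>)"
    using assms unfolding holo_poly_def by blast
  then have "f = (\<lambda>z. \<Sum>\<alpha>\<in>S. a \<alpha> * mono z \<alpha>)" by auto
  then show ?thesis by (simp only:) (intro polyfun_sum polyfun_mult polyfun_const polyfun_mono)
qed

text \<open>On such a \<open>V\<close> it suffices to look at the line joining a non-zero of \<open>F\<close> to a non-zero of \<open>G\<close>.\<close>
lemma polyfun_domain:
  assumes F: "polyfun F" and G: "polyfun G"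
    and V: "\<And>p q t. p \<in> V \<Longrightarrow> q \<in> V \<Longrightarrow> (\<lambda>i. p i + t * (q i - p i)) \<in> V"
    and prod: "\<And>z. z \<in> V \<Longrightarrow> F z * G z = 0"
  shows "(\<forall>z\<in>V. F z = 0) \<or> (\<forall>z\<in>V. G z = 0)"
proof (rule ccontr)
  assume "\<not> ?thesis"
  then obtain p q where pq: "p \<in> V" "q \<in> V" "F p \<noteq> 0" "G q \<noteq> 0" by auto
  let ?l = "\<lambda>t i. p i + t * (q i - p i)"
  obtain P where P: "\<And>t. F (?l t) = poly P t"
    by (rule polyfun_lineE[OF F, of p "\<lambda>i. q i - p i"]) (rule that)
  obtain Q where Q: "\<And>t. G (?l t) = poly Q t"
    by (rule polyfun_lineE[OF G, of p "\<lambda>i. q i - p i"]) (rule that)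
  have "poly (P * Q) t = 0" for t
    using prod[OF V[OF pq(1,2)], of t] by (simp add: P Q)
  then have "P * Q = 0" using poly_all_0_iff_0 by blast
  moreover have "P \<noteq> 0" using P[of 0] pq by auto
  moreover have "Q \<noteq> 0" using Q[of 1] pq by auto
  ultimately show False by simp
qed

text \<open>There are no zero divisors (\<open>polyfun_domain\<close> with \<open>V = UNIV\<close>),
  so a factor that is nonzero at one point \<open>p\<close> cancels everywhere, its own zeros
  included.\<close>

lemma polyfun_cancel:
  assumes "polyfun F" "polyfun G" "polyfun g" "g p \<noteq> 0"
    and eq: "\<And>z. g z * F z = g z * G z"
  shows "F z = G z"
  using polyfun_domain[of g "\<lambda>z. F z - G z" UNIV] assms
  by (auto simp: right_diff_distrib)

text \<open>Writing the two halves of \<open>u\<close> as \<open>a + \<i>b\<close> and \<open>a - \<i>b\<close>, the hypothesis covers all real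
  \<open>a\<close> and \<open>b\<close>; the line \<open>t \<mapsto> (Re a + t Im a, Re b + t Im b)\<close> reaches the given point at \<open>t = \<i>\<close>.\<close>
lemma polyfun_polarization:
  fixes F :: "('i + 'i \<Rightarrow> complex) \<Rightarrow> complex"
  assumes F: "polyfun F"
    and diag: "\<And>u. (\<And>i. u (Inr i) = cnj (u (Inl i))) \<Longrightarrow> F u = 0"
  shows "F u = 0"
proof -
  define a where "a i = (u (Inl i) + u (Inr i)) / 2" for i
  define b where "b i = (u (Inl i) - u (Inr i)) / (2 * \<i>)" for i
  define p where "p = case_sum (\<lambda>i. complex_of_real (Re (a i)) + \<i> * of_real (Re (b i)))
                               (\<lambda>i. complex_of_real (Re (a i)) - \<i> * of_real (Re (b i)))"
  define v where "v = case_sum (\<lambda>i. complex_of_real (Im (a i)) + \<i> * of_real (Im (b i)))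
                               (\<lambda>i. complex_of_real (Im (a i)) - \<i> * of_real (Im (b i)))"
  obtain P where P: "\<And>t. F (\<lambda>i. p i + t * v i) = poly P t"
    by (rule polyfun_lineE[OF F, of p v]) (rule that)
  have "poly P (complex_of_real t) = 0" for t
    unfolding P[symmetric] by (rule diag) (simp add: p_def v_def algebra_simps)
  then have "range complex_of_real \<subseteq> {t. poly P t = 0}" by auto
  moreover have "infinite (range complex_of_real)"
    using finite_imageD[of complex_of_real UNIV] infinite_UNIV_char_0 by (auto simp: inj_of_real)
  ultimately have "P = 0" using poly_roots_finite finite_subset by blast
  have sp: "complex_of_real (Re x) + \<i> * of_real (Im x) = x" for x
    by (simp add: complex_eq_iff)
  have "p i + \<i> * v i = u i" for i
  proof (cases i)
    case (Inl j)
    have "p i + \<i> * v i = a j + \<i> * b j"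
      unfolding p_def v_def Inl using sp[of "a j"] sp[of "b j"] by (simp add: algebra_simps complex_eq_iff)
    also have "\<dots> = u i" unfolding a_def b_def Inl by (simp add: field_simps)
    finally show ?thesis .
  next
    case (Inr j)
    have "p i + \<i> * v i = a j - \<i> * b j"
      unfolding p_def v_def Inr using sp[of "a j"] sp[of "b j"] by (simp add: algebra_simps complex_eq_iff)
    also have "\<dots> = u i" unfolding a_def b_def Inr by (simp add: field_simps)
    finally show ?thesis .
  qed
  then have "u = (\<lambda>i. p i + \<i> * v i)" by auto
  then show ?thesis using P[of \<i>] \<open>P = 0\<close> by simp
qed

text \<open>The alternative is a finite combination of point evaluations killing every \<open>\<phi> i\<close> but not \<open>\<psi>\<close>.\<close>
lemma span_or_separated:
  fixes \<phi> :: "'i \<Rightarrow> 'x \<Rightarrow> 'a :: field"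
  assumes "finite I"
  shows "(\<exists>a. \<forall>x\<in>X. \<psi> x = (\<Sum>i\<in>I. a i * \<phi> i x)) \<or>
    (\<exists>T c. finite T \<and> T \<subseteq> X \<and> (\<forall>i\<in>I. (\<Sum>x\<in>T. c x * \<phi> i x) = 0) \<and> (\<Sum>x\<in>T. c x * \<psi> x) \<noteq> 0)"
  using assms
proof (induction I arbitrary: \<psi> rule: finite_induct)
  case empty
  show ?case
  proof (cases "\<forall>x\<in>X. \<psi> x = 0")
    case False
    then obtain x where "x \<in> X" "\<psi> x \<noteq> 0" by auto
    then show ?thesis by (intro disjI2 exI[of _ "{x}"] exI[of _ "\<lambda>_. 1"]) auto
  qed auto
next
  case (insert k I)
  from insert.IH[of "\<phi> k"] show ?case
  proof (elim disjE exE conjE)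
    fix b assume b: "\<forall>x\<in>X. \<phi> k x = (\<Sum>i\<in>I. b i * \<phi> i x)"
    from insert.IH[of \<psi>] show ?case
    proof (elim disjE exE conjE)
      fix a assume a: "\<forall>x\<in>X. \<psi> x = (\<Sum>i\<in>I. a i * \<phi> i x)"
      have "\<forall>x\<in>X. \<psi> x = (\<Sum>i\<in>insert k I. (if i = k then 0 else a i) * \<phi> i x)"
        using a insert.hyps by (auto intro!: sum.cong)
      then show ?case by (intro disjI1 exI[of _ "\<lambda>i. if i = k then 0 else a i"])
    next
      fix T c assume T: "finite T" "T \<subseteq> X" "\<forall>i\<in>I. (\<Sum>x\<in>T. c x * \<phi> i x) = 0" "(\<Sum>x\<in>T. c x * \<psi> x) \<noteq> 0"
      have "(\<Sum>x\<in>T. c x * \<phi> k x) = (\<Sum>x\<in>T. \<Sum>i\<in>I. b i * (c x * \<phi> i x))"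
      proof (rule sum.cong[OF refl])
        fix x assume "x \<in> T"
        then have "\<phi> k x = (\<Sum>i\<in>I. b i * \<phi> i x)" using T(2) b by blast
        then show "c x * \<phi> k x = (\<Sum>i\<in>I. b i * (c x * \<phi> i x))"
          by (simp add: sum_distrib_left mult.left_commute)
      qed
      also have "\<dots> = (\<Sum>i\<in>I. b i * (\<Sum>x\<in>T. c x * \<phi> i x))"
        by (subst sum.swap) (simp add: sum_distrib_left)
      also have "\<dots> = 0" using T by simp
      finally show ?case using T by (intro disjI2 exI[of _ T] exI[of _ c]) auto
    qed
  next
    fix T c assume T: "finite T" "T \<subseteq> X" "\<forall>i\<in>I. (\<Sum>x\<in>T. c x * \<phi> i x) = 0" "(\<Sum>x\<in>T. c x * \<phi> k x) \<noteq> 0"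
    \<comment> \<open>With this \<open>m\<close> the functional given by \<open>T\<close> and
      \<open>c\<close> vanishes on \<open>\<psi> - m * \<phi> k\<close>, so subtracting multiples of
      it from another functional keeps the value there.\<close>
    define m where "m = (\<Sum>x\<in>T. c x * \<psi> x) / (\<Sum>x\<in>T. c x * \<phi> k x)"
    from insert.IH[of "\<lambda>x. \<psi> x - m * \<phi> k x"] show ?case
    proof (elim disjE exE conjE)
      fix a assume a: "\<forall>x\<in>X. \<psi> x - m * \<phi> k x = (\<Sum>i\<in>I. a i * \<phi> i x)"
      have "\<forall>x\<in>X. \<psi> x = (\<Sum>i\<in>insert k I. (if i = k then m else a i) * \<phi> i x)"
      proof
        fix x assume "x \<in> X"
        have "(\<Sum>i\<in>I. (if i = k then m else a i) * \<phi> i x) = (\<Sum>i\<in>I. a i * \<phi> i x)"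
          using insert.hyps by (intro sum.cong) auto
        then show "\<psi> x = (\<Sum>i\<in>insert k I. (if i = k then m else a i) * \<phi> i x)"
          using a \<open>x \<in> X\<close> insert.hyps by (auto simp: algebra_simps)
      qed
      then show ?case by (intro disjI1 exI[of _ "\<lambda>i. if i = k then m else a i"])
    next
      fix T' c' assume T': "finite T'" "T' \<subseteq> X" "\<forall>i\<in>I. (\<Sum>x\<in>T'. c' x * \<phi> i x) = 0"
        "(\<Sum>x\<in>T'. c' x * (\<psi> x - m * \<phi> k x)) \<noteq> 0"
      \<comment> \<open>Subtracting \<open>s\<close> times the functional on \<open>T\<close> from
        the one on \<open>T'\<close> removes the value at \<open>\<phi> k\<close>; both already kill
        the functions indexed by \<open>I\<close>.\<close>
      define s where "s = (\<Sum>x\<in>T'. c' x * \<phi> k x) / (\<Sum>x\<in>T. c x * \<phi> k x)"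
      define d where "d x = (if x \<in> T' then c' x else 0) - s * (if x \<in> T then c x else 0)" for x
      have D: "(\<Sum>x\<in>T \<union> T'. d x * f x) = (\<Sum>x\<in>T'. c' x * f x) - s * (\<Sum>x\<in>T. c x * f x)" for f
      proof -
        have "(\<Sum>x\<in>T \<union> T'. d x * f x) = (\<Sum>x\<in>T \<union> T'. if x \<in> T' then c' x * f x else 0)
            - (\<Sum>x\<in>T \<union> T'. if x \<in> T then s * (c x * f x) else 0)"
          unfolding d_def sum_subtractf[symmetric] by (intro sum.cong) (auto simp: algebra_simps)
        also have "\<dots> = (\<Sum>x\<in>T'. c' x * f x) - (\<Sum>x\<in>T. s * (c x * f x))"
          using T T' by (simp add: sum.inter_restrict[symmetric] Int_absorb1)
        finally show ?thesis by (simp add: sum_distrib_left)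
      qed
      have "(\<Sum>x\<in>T'. c' x * (\<psi> x - m * \<phi> k x)) = (\<Sum>x\<in>T'. c' x * \<psi> x) - m * (\<Sum>x\<in>T'. c' x * \<phi> k x)"
        by (simp add: right_diff_distrib sum_subtractf sum_distrib_left mult.left_commute)
      moreover have "m * (\<Sum>x\<in>T'. c' x * \<phi> k x) = s * (\<Sum>x\<in>T. c x * \<psi> x)"
        by (simp add: m_def s_def)
      ultimately have "(\<Sum>x\<in>T \<union> T'. d x * \<psi> x) = (\<Sum>x\<in>T'. c' x * (\<psi> x - m * \<phi> k x))"
        unfolding D by simp
      moreover have "\<forall>i\<in>insert k I. (\<Sum>x\<in>T \<union> T'. d x * \<phi> i x) = 0"
        unfolding D using T T' by (auto simp: s_def)
      ultimately show ?case using T T' by (intro disjI2 exI[of _ "T \<union> T'"] exI[of _ d]) auto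
    qed
  qed
qed

lemma left_eigenvector:
  fixes A :: "nat \<Rightarrow> nat \<Rightarrow> complex"
  assumes "n \<noteq> 0"
  shows "\<exists>l w. (\<exists>i<n. w i \<noteq> 0) \<and> (\<forall>k<n. (\<Sum>j<n. w j * A j k) = l * w k)"
proof -
  \<comment> \<open>\<open>M\<close> is the transpose of \<open>A\<close>, so its right eigenvectors
    are the left eigenvectors wanted.\<close>
  define M where "M = mat n n (\<lambda>(k, j). A j k)"
  have M: "M \<in> carrier_mat n n" by (simp add: M_def)
  obtain l where "eigenvalue M l" using spectrum_non_empty[OF M] assms by (auto simp: spectrum_def)
  then obtain v where v: "v \<in> carrier_vec n" "v \<noteq> 0\<^sub>v n" "M *\<^sub>v v = l \<cdot>\<^sub>v v"
    using M unfolding eigenvalue_def eigenvector_def by auto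
  have "(\<Sum>j<n. v $ j * A j k) = l * v $ k" if "k < n" for k
  proof -
    have "(M *\<^sub>v v) $ k = (\<Sum>j<n. v $ j * A j k)"
      using that v(1) by (auto simp: M_def scalar_prod_def lessThan_atLeast0 mult.commute intro!: sum.cong)
    then show ?thesis using v that by simp
  qed
  moreover have "\<exists>i<n. v $ i \<noteq> 0"
    using v by (metis eq_vecI carrier_vecD index_zero_vec)
  ultimately show ?thesis by (intro exI[of _ l] exI[of _ "\<lambda>i. v $ i"]) auto
qed

section \<open>Linear syzygies in at most three variables\<close>

definition lform :: "nat \<Rightarrow> (nat \<Rightarrow> complex) \<Rightarrow> (nat \<Rightarrow> complex) \<Rightarrow> complex" where
  "lform n w z = (\<Sum>j<n. w j * z j)"

lemma polyfun_lform [intro]: "polyfun (lform n w)"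
  unfolding lform_def[abs_def] by (intro polyfun_sum polyfun_mult polyfun_const polyfun_coord)

text \<open>This makes kernels of linear forms closed under the lines required of \<open>V\<close>
  in \<open>polyfun_domain\<close>.\<close>

lemma lform_line: "lform n w (\<lambda>i. p i + t * (q i - p i)) = (1 - t) * lform n w p + t * lform n w q"
  by (simp add: lform_def sum_distrib_left algebra_simps sum.distrib sum_subtractf)

text \<open>Duality: coefficient vectors are treated as functions on \<open>{..<n}\<close>. A
  separating combination of evaluations is itself a point \<open>z\<close> where all forms
  \<open>u i\<close> vanish but \<open>x\<close> does not, contrary to \<open>van\<close>.\<close>

lemma lform_span:
  assumes "finite I" and van: "\<And>z. (\<And>i. i \<in> I \<Longrightarrow> lform n (u i) z = 0) \<Longrightarrow> lform n x z = 0"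
  obtains a where "\<And>j. j < n \<Longrightarrow> x j = (\<Sum>i\<in>I. a i * u i j)"
proof -
  have "\<not> (\<exists>T c. finite T \<and> T \<subseteq> {..<n} \<and> (\<forall>i\<in>I. (\<Sum>j\<in>T. c j * u i j) = 0) \<and> (\<Sum>j\<in>T. c j * x j) \<noteq> 0)"
  proof (intro notI, elim exE conjE)
    fix T c assume T: "finite T" "T \<subseteq> {..<n}" "\<forall>i\<in>I. (\<Sum>j\<in>T. c j * u i j) = 0" "(\<Sum>j\<in>T. c j * x j) \<noteq> 0"
    define z where "z j = (if j \<in> T then c j else 0)" for j
    have "lform n w z = (\<Sum>j\<in>T. c j * w j)" for w
    proof -
      have "lform n w z = (\<Sum>j<n. if j \<in> T then c j * w j else 0)"
        unfolding lform_def z_def by (intro sum.cong) auto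
      then show ?thesis using T(2) by (simp add: sum.inter_restrict[symmetric] Int_absorb1)
    qed
    with van[of z] T show False by auto
  qed
  with span_or_separated[OF assms(1), of "{..<n}" x u]
  obtain a where "\<forall>j\<in>{..<n}. x j = (\<Sum>i\<in>I. a i * u i j)" by metis
  then show thesis using that by auto
qed

lemma lform_multiple:
  assumes "\<And>z. lform n u z = 0 \<Longrightarrow> lform n x z = 0"
  obtains k where "\<And>j. j < n \<Longrightarrow> x j = k * u j"
proof -
  obtain a where "\<And>j. j < n \<Longrightarrow> x j = (\<Sum>i\<in>{()}. a i * u j)"
    by (rule lform_span[of "{()}" n "\<lambda>_. u" x]) (use assms in auto)
  then show thesis using that[of "a ()"] by simp
qed

lemma lform_span2:
  assumes "\<And>z. lform n u z = 0 \<Longrightarrow> lform n w z = 0 \<Longrightarrow> lform n x z = 0"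
  obtains k l where "\<And>j. j < n \<Longrightarrow> x j = k * u j + l * w j"
proof -
  obtain a where "\<And>j. j < n \<Longrightarrow> x j = (\<Sum>i\<in>{True,False}. a i * (if i then u else w) j)"
  proof (rule lform_span[of "{True,False}" n "\<lambda>i. if i then u else w" x])
    fix z assume "\<And>i. i \<in> {True, False} \<Longrightarrow> lform n (if i then u else w) z = 0"
    from this[of True] this[of False] show "lform n x z = 0" using assms by simp
  qed auto
  then show thesis using that[of "a True" "a False"] by simp
qed

lemma lform_cong_scale: "(\<And>j. j < n \<Longrightarrow> x j = k * u j) \<Longrightarrow> lform n x z = k * lform n u z"
  by (simp add: lform_def sum_distrib_left mult.assoc)

text \<open>The kernel of a linear form is irreducible, so one factor vanishes on it and is a
  multiple of that form.\<close>

lemma lform_product_zero: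
  assumes "\<And>z. lform n a z = 0 \<Longrightarrow> lform n x z * lform n y z = 0"
  shows "(\<exists>k. \<forall>j<n. x j = k * a j) \<or> (\<exists>k. \<forall>j<n. y j = k * a j)"
proof -
  have "(\<forall>z\<in>{z. lform n a z = 0}. lform n x z = 0) \<or> (\<forall>z\<in>{z. lform n a z = 0}. lform n y z = 0)"
    by (rule polyfun_domain[OF polyfun_lform polyfun_lform])
      (use assms in \<open>simp_all add: lform_line\<close>)
  then show ?thesis
  proof
    assume "\<forall>z\<in>{z. lform n a z = 0}. lform n x z = 0"
    then obtain k where "\<And>j. j < n \<Longrightarrow> x j = k * a j" using lform_multiple[of n a x] by auto
    then show ?thesis by auto
  next
    assume "\<forall>z\<in>{z. lform n a z = 0}. lform n y z = 0"
    then obtain k where "\<And>j. j < n \<Longrightarrow> y j = k * a j" using lform_multiple[of n a y] by auto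
    then show ?thesis by auto
  qed
qed

lemma lform_comp:
  "lform n (\<lambda>k. \<Sum>j<n. w j * A j k) z = (\<Sum>j<n. w j * lform n (A j) z)"
  unfolding lform_def sum_distrib_left sum_distrib_right by (subst sum.swap) (simp add: mult.assoc)

text \<open>Pairing with a left eigenvector \<open>w\<close> of \<open>A\<close> gives \<open>(w \<cdot> z) (g - l f) = 0\<close>.\<close>
lemma linear_multiple_imp_proportional:
  assumes n: "n \<noteq> 0" and f: "polyfun f" and g: "polyfun g"
    and eq: "\<And>z j. j < n \<Longrightarrow> z j * g z = lform n (A j) z * f z"
  shows "\<exists>l. \<forall>z. g z = l * f z"
proof -
  obtain l w where w: "\<exists>i<n. w i \<noteq> 0" and ev: "\<forall>k<n. (\<Sum>j<n. w j * A j k) = l * w k"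
    using left_eigenvector[OF n, of A] by auto
  have "lform n w z * g z = lform n w z * (l * f z)" for z
  proof -
    have "lform n w z * g z = (\<Sum>j<n. w j * (z j * g z))"
      by (simp add: lform_def sum_distrib_right mult.assoc)
    also have "\<dots> = (\<Sum>j<n. w j * lform n (A j) z) * f z"
      by (simp add: eq sum_distrib_right mult.assoc)
    also have "(\<Sum>j<n. w j * lform n (A j) z) = l * lform n w z"
      unfolding lform_comp[symmetric] using ev by (intro lform_cong_scale) auto
    finally show ?thesis by simp
  qed
  moreover obtain i where i: "i < n" "w i \<noteq> 0" using w by auto
  then have "lform n w (\<lambda>j. if j = i then 1 else 0) \<noteq> 0" by (simp add: lform_def if_distrib cong: if_cong)
  ultimately show ?thesis
    using polyfun_cancel[OF g polyfun_mult[OF polyfun_const f] polyfun_lform] by blast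
qed

text \<open>A sum of two rank-one matrices of size 3 has determinant 0, here expanded along the
  first row, whereas the identity has determinant 1.\<close>

lemma rank_two_not_identity:
  fixes u w q p :: "nat \<Rightarrow> complex"
  assumes "\<And>j k. j < 3 \<Longrightarrow> k < 3 \<Longrightarrow> u k * q j + w k * p j = (if j = k then 1 else 0)"
  shows False
proof -
  define M where "M j k = u k * q j + w k * p j" for j k
  have "M 0 0 * (M 1 1 * M 2 2 - M 1 2 * M 2 1) - M 0 1 * (M 1 0 * M 2 2 - M 1 2 * M 2 0)
     + M 0 2 * (M 1 0 * M 2 1 - M 1 1 * M 2 0) = 0"
    unfolding M_def by (simp add: algebra_simps)
  moreover have "M j k = (if j = k then 1 else 0)" if "j < 3" "k < 3" for j k
    using assms that by (simp add: M_def)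
  ultimately show False by simp
qed

text \<open>With \<open>a = w B\<close> and \<open>b = u A\<close>, pairing with \<open>w\<close> and \<open>u\<close> gives \<open>w g = a f\<^sub>2\<close> and \<open>u g = b f\<^sub>1\<close>, hence
  \<open>a b z = u a (A z) + w b (B z)\<close>. If \<open>a\<close>, \<open>b\<close> are not proportional, restricting to the planes
  \<open>a = 0\<close> and \<open>b = 0\<close> shows that \<open>A\<close> and \<open>B\<close> have rank one, so the identity matrix would have
  rank at most two. Otherwise \<open>a\<close> vanishes on \<open>u = w = 0\<close>, which puts \<open>g\<close> in the span of \<open>f\<^sub>1\<close>, \<open>f\<^sub>2\<close>.\<close>
lemma linear_syzygy_three_normalized:
  assumes f1: "polyfun f1" and f2: "polyfun f2" and g: "polyfun g"
    and eq: "\<And>z j. j < 3 \<Longrightarrow> z j * g z = lform 3 (A j) z * f1 z + lform 3 (B j) z * f2 z"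
    and w0: "\<exists>i<3. w i \<noteq> 0" and u0: "\<exists>i<3. u i \<noteq> 0"
    and wA: "\<And>k. k < 3 \<Longrightarrow> (\<Sum>j<3. w j * A j k) = 0"
    and uB: "\<And>k. k < 3 \<Longrightarrow> (\<Sum>j<3. u j * B j k) = 0"
  shows "\<exists>\<alpha> \<beta>. \<forall>z. g z = \<alpha> * f1 z + \<beta> * f2 z"
proof (rule ccontr)
  assume neg: "\<not> ?thesis"
  then have indep: "\<not> (\<forall>z. g z = \<alpha> * f1 z + \<beta> * f2 z)" for \<alpha> \<beta> by auto
  define L where "L = lform 3"
  define a where "a k = (\<Sum>j<3. w j * B j k)" for k
  define b where "b k = (\<Sum>j<3. u j * A j k)" for k
  have comb: "L x z * g z = L (\<lambda>k. \<Sum>j<3. x j * A j k) z * f1 z + L (\<lambda>k. \<Sum>j<3. x j * B j k) z * f2 z" for x z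
  proof -
    have "L x z * g z = (\<Sum>j<3. x j * (z j * g z))"
      by (simp add: L_def lform_def sum_distrib_right mult.assoc)
    also have "\<dots> = (\<Sum>j<3. x j * (lform 3 (A j) z * f1 z + lform 3 (B j) z * f2 z))"
      by (intro sum.cong) (auto simp: eq)
    also have "\<dots> = (\<Sum>j<3. x j * lform 3 (A j) z) * f1 z + (\<Sum>j<3. x j * lform 3 (B j) z) * f2 z"
      by (simp add: sum_distrib_left sum_distrib_right sum.distrib algebra_simps)
    finally show ?thesis unfolding L_def lform_comp .
  qed
  have zero: "L x z = 0" if "\<And>k. k < 3 \<Longrightarrow> x k = 0" for x z
    using that by (simp add: L_def lform_def)
  have wg: "L w z * g z = L a z * f2 z" for z
    using comb[of w z] zero[of "\<lambda>k. \<Sum>j<3. w j * A j k" z] wA by (simp add: a_def[abs_def])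
  have ug: "L u z * g z = L b z * f1 z" for z
    using comb[of u z] zero[of "\<lambda>k. \<Sum>j<3. u j * B j k" z] uB by (simp add: b_def[abs_def])
  have Lnz: "\<exists>z. L x z \<noteq> 0" if "\<exists>i<3. x i \<noteq> 0" for x
  proof -
    from that obtain i where "i < 3" "x i \<noteq> 0" by auto
    then have "L x (\<lambda>j. if j = i then 1 else 0) \<noteq> 0"
      by (simp add: L_def lform_def if_distrib cong: if_cong)
    then show ?thesis by blast
  qed
  have pL: "polyfun (L x)" for x by (simp add: L_def polyfun_lform)
  obtain zg where zg: "g zg \<noteq> 0" using indep[of 0 0] by auto
  \<comment> \<open>If \<open>a\<close> were a multiple of \<open>w\<close>, cancelling
    \<open>w\<close> would make \<open>g\<close> a multiple of \<open>f2\<close>; \<open>bu\<close>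
    is the mirror statement. The multiple 0 shows that \<open>a\<close> and \<open>b\<close> are
    nonzero.\<close>
  have aw: False if "\<And>k. k < 3 \<Longrightarrow> a k = c * w k" for c
  proof -
    have "L w z * g z = L w z * (c * f2 z)" for z
      using wg[of z] lform_cong_scale[of 3 a c w z] that by (simp add: L_def)
    then have "g z = c * f2 z" for z
      using polyfun_cancel[OF g polyfun_mult[OF polyfun_const f2] pL] Lnz[OF w0] by metis
    then show False using indep[of 0 c] by auto
  qed
  have bu: False if "\<And>k. k < 3 \<Longrightarrow> b k = c * u k" for c
  proof -
    have "L u z * g z = L u z * (c * f1 z)" for z
      using ug[of z] lform_cong_scale[of 3 b c u z] that by (simp add: L_def)
    then have "g z = c * f1 z" for z
      using polyfun_cancel[OF g polyfun_mult[OF polyfun_const f1] pL] Lnz[OF u0] by metis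
    then show False using indep[of c 0] by auto
  qed
  have a0: "\<exists>i<3. a i \<noteq> 0" using aw[of 0] by auto
  have b0: "\<exists>i<3. b i \<noteq> 0" using bu[of 0] by auto
  have wa: False if "\<And>k. k < 3 \<Longrightarrow> w k = c * a k" for c
    using aw[of "1 / c"] that w0 by (cases "c = 0") auto
  have ub: False if "\<And>k. k < 3 \<Longrightarrow> u k = c * b k" for c
    using bu[of "1 / c"] that u0 by (cases "c = 0") auto
  \<comment> \<open>Multiply the vector equation by \<open>a\<close> and \<open>b\<close>. By
    \<open>wg\<close> and \<open>ug\<close> the products of \<open>b\<close> with \<open>f1\<close>
    and of \<open>a\<close> with \<open>f2\<close> become those of \<open>u\<close> and
    \<open>w\<close> with \<open>g\<close>, so \<open>g\<close> cancels.\<close>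
  have main: "L a z * L b z * z j = L u z * L a z * lform 3 (A j) z + L w z * L b z * lform 3 (B j) z"
    if j: "j < 3" for z j
  proof -
    have "g z * (L a z * L b z * z j)
        = g z * (L u z * L a z * lform 3 (A j) z + L w z * L b z * lform 3 (B j) z)" for z
    proof -
    have "g z * (L a z * L b z * z j) = L a z * L b z * (z j * g z)" by simp
    also have "\<dots> = L a z * (L b z * f1 z) * lform 3 (A j) z + L b z * (L a z * f2 z) * lform 3 (B j) z"
      unfolding eq[OF j] by (simp add: algebra_simps)
    finally show ?thesis
      unfolding wg[symmetric] ug[symmetric] by (simp add: algebra_simps)
    qed
    then show ?thesis
      by (intro polyfun_cancel[where F = "\<lambda>z. L a z * L b z * z j" and z = z and p = zg and g = g and
            G = "\<lambda>z. L u z * L a z * lform 3 (A j) z + L w z * L b z * lform 3 (B j) z"]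
            g zg polyfun_add polyfun_mult pL polyfun_coord polyfun_lform)
  qed
  show False
  proof (cases "\<exists>c. \<forall>k<3. b k = c * a k")
    case True
    then obtain c where c: "\<And>k. k < 3 \<Longrightarrow> b k = c * a k" by auto
    then have Lb: "L b z = c * L a z" for z by (simp add: L_def lform_cong_scale)
    have "c \<noteq> 0" using c b0 by auto
    have red: "c * L a z * z j = L u z * lform 3 (A j) z + c * L w z * lform 3 (B j) z" if "j < 3" for z j
    proof -
      obtain za where za: "L a za \<noteq> 0" using Lnz[OF a0] by auto
      show ?thesis
      proof (rule polyfun_cancel[where F = "\<lambda>z. c * L a z * z j" and z = z and p = za and g = "L a" and
            G = "\<lambda>z. L u z * lform 3 (A j) z + c * L w z * lform 3 (B j) z"])
        show "L a z * (c * L a z * z j) = L a z * (L u z * lform 3 (A j) z + c * L w z * lform 3 (B j) z)" for z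
          using main[OF that, of z] by (simp add: Lb algebra_simps)
      qed (intro za polyfun_add polyfun_mult pL polyfun_lform polyfun_const polyfun_coord)+
    qed
    \<comment> \<open>Where \<open>u\<close> and \<open>w\<close> vanish, \<open>red\<close> says
      that \<open>a\<close> times each coordinate is 0; if \<open>a\<close> were nonzero there, the
      point would be the origin, where \<open>a\<close> is 0.\<close>
    have "L a z = 0" if "L u z = 0" "L w z = 0" for z
    proof (rule ccontr)
      assume "L a z \<noteq> 0"
      then have "z j = 0" if "j < 3" for j using red[OF that, of z] \<open>L u z = 0\<close> \<open>L w z = 0\<close> \<open>c \<noteq> 0\<close> by auto
      then show False using \<open>L a z \<noteq> 0\<close> by (simp add: L_def lform_def)
    qed
    then obtain k l where kl: "\<And>j. j < 3 \<Longrightarrow> a j = k * u j + l * w j"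
      using lform_span2[of 3 u w a] unfolding L_def by metis
    have La: "L a z = k * L u z + l * L w z" for z
      using kl by (simp add: L_def lform_def algebra_simps sum.distrib sum_distrib_left)
    have "L a z * g z = L a z * (k * c * f1 z + l * f2 z)" for z
    proof -
      have "L a z * g z = k * (L u z * g z) + l * (L w z * g z)"
        by (subst La) (simp add: algebra_simps)
      then show ?thesis unfolding wg ug Lb by (simp add: algebra_simps)
    qed
    then have "g z = k * c * f1 z + l * f2 z" for z
      using polyfun_cancel[OF g polyfun_add[OF polyfun_mult[OF polyfun_const f1] polyfun_mult[OF polyfun_const f2]] pL]
        Lnz[OF a0] by metis
    then show False using indep by blast
  next
    case False
    have nab: False if "\<And>k. k < 3 \<Longrightarrow> a k = c * b k" for c
      using False that a0 by (cases "c = 0") (auto dest!: spec[of _ "1 / c"])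
    \<comment> \<open>On the plane \<open>a = 0\<close> only the product of \<open>w\<close>,
      \<open>b\<close> and \<open>B j\<close> survives in \<open>main\<close>. Neither
      \<open>w\<close> nor \<open>b\<close> vanishes identically on it, so \<open>B j\<close>
      does.\<close>
    have "\<exists>k. \<forall>i<3. B j i = k * a i" if j: "j < 3" for j
    proof -
      have "L w z * (L b z * L (B j) z) = 0" if "L a z = 0" for z
        using main[OF j, of z] that by (simp add: L_def)
      then have v: "L a z = 0 \<Longrightarrow> L w z = 0 \<or> L b z * L (B j) z = 0" for z by auto
      have "(\<forall>z\<in>{z. L a z = 0}. L w z = 0) \<or> (\<forall>z\<in>{z. L a z = 0}. L b z * L (B j) z = 0)"
        by (rule polyfun_domain[OF pL polyfun_mult[OF pL pL]])
          (use v in \<open>simp_all add: L_def lform_line\<close>)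
      then show ?thesis
      proof
        assume "\<forall>z\<in>{z. L a z = 0}. L w z = 0"
        then show ?thesis using lform_multiple[of 3 a w] wa by (simp add: L_def) metis
      next
        assume "\<forall>z\<in>{z. L a z = 0}. L b z * L (B j) z = 0"
        then show ?thesis using lform_product_zero[of 3 a b "B j"] False by (auto simp: L_def)
      qed
    qed
    then obtain p where "\<And>j i. j < 3 \<Longrightarrow> i < 3 \<Longrightarrow> B j i = p j * a i" by metis
    then have LB: "j < 3 \<Longrightarrow> lform 3 (B j) z = p j * L a z" for j z
      unfolding L_def by (intro lform_cong_scale) auto
    have "\<exists>k. \<forall>i<3. A j i = k * b i" if j: "j < 3" for j
    proof -
      have "L u z * (L a z * L (A j) z) = 0" if "L b z = 0" for z
        using main[OF j, of z] that by (simp add: L_def)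
      then have v: "L b z = 0 \<Longrightarrow> L u z = 0 \<or> L a z * L (A j) z = 0" for z by auto
      have "(\<forall>z\<in>{z. L b z = 0}. L u z = 0) \<or> (\<forall>z\<in>{z. L b z = 0}. L a z * L (A j) z = 0)"
        by (rule polyfun_domain[OF pL polyfun_mult[OF pL pL]])
          (use v in \<open>simp_all add: L_def lform_line\<close>)
      then show ?thesis
      proof
        assume "\<forall>z\<in>{z. L b z = 0}. L u z = 0"
        then show ?thesis using lform_multiple[of 3 b u] ub by (simp add: L_def) metis
      next
        assume "\<forall>z\<in>{z. L b z = 0}. L a z * L (A j) z = 0"
        then show ?thesis using lform_product_zero[of 3 b a "A j"] nab by (auto simp: L_def)
      qed
    qed
    then obtain q where "\<And>j i. j < 3 \<Longrightarrow> i < 3 \<Longrightarrow> A j i = q j * b i" by metis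
    then have LA: "j < 3 \<Longrightarrow> lform 3 (A j) z = q j * L b z" for j z
      unfolding L_def by (intro lform_cong_scale) auto
    obtain za where za: "L a za \<noteq> 0" using Lnz[OF a0] by auto
    obtain zb where zb: "L b zb \<noteq> 0" using Lnz[OF b0] by auto
    \<comment> \<open>With the rank-one forms inserted, both sides of \<open>main\<close> contain
      \<open>a\<close> and \<open>b\<close>. Cancelling \<open>a\<close> here and \<open>b\<close>
      next writes the identity matrix as a sum of two rank-one matrices.\<close>
    have id1: "L b z * z j = L b z * (L u z * q j + L w z * p j)" if "j < 3" for z j
    proof (rule polyfun_cancel[where F = "\<lambda>z. L b z * z j" and z = z and p = za and g = "L a" and
          G = "\<lambda>z. L b z * (L u z * q j + L w z * p j)"])
      show "L a z * (L b z * z j) = L a z * (L b z * (L u z * q j + L w z * p j))" for z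
        using main[OF that, of z] LA[OF that] LB[OF that] by (simp add: algebra_simps)
    qed (intro za polyfun_add polyfun_mult pL polyfun_const polyfun_coord)+
    have id: "z j = L u z * q j + L w z * p j" if "j < 3" for z j
      by (rule polyfun_cancel[where F = "\<lambda>z. z j" and z = z and p = zb and g = "L b" and
          G = "\<lambda>z. L u z * q j + L w z * p j", OF _ _ _ _ id1[OF that]])
        (intro zb polyfun_add polyfun_mult pL polyfun_const polyfun_coord)+
    have "u k * q j + w k * p j = (if j = k then 1 else 0)" if "j < 3" "k < 3" for j k
      using id[OF that(1), of "\<lambda>i. if i = k then 1 else 0"] that(2)
      by (auto simp: L_def lform_def if_distrib[of "\<lambda>x. _ * x"] cong: if_cong split: if_splits)
    then show False by (rule rank_two_not_identity)
  qed
qed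

text \<open>Subtracting an eigenvalue from the diagonal of each of \<open>A\<close> and
  \<open>B\<close> makes both singular. The change is absorbed by passing to
  \<open>g - l * f1 - m * f2\<close>, which does not affect membership in the span.\<close>

lemma linear_syzygy_three:
  assumes f1: "polyfun f1" and f2: "polyfun f2" and g: "polyfun g"
    and eq: "\<And>z j. j < 3 \<Longrightarrow> z j * g z = lform 3 (A j) z * f1 z + lform 3 (B j) z * f2 z"
  shows "\<exists>\<alpha> \<beta>. \<forall>z. g z = \<alpha> * f1 z + \<beta> * f2 z"
proof -
  obtain l w where w: "\<exists>i<3. w i \<noteq> 0" "\<forall>k<3. (\<Sum>j<3. w j * A j k) = l * w k"
    using left_eigenvector[of 3 A] by auto
  obtain m u where u: "\<exists>i<3. u i \<noteq> 0" "\<forall>k<3. (\<Sum>j<3. u j * B j k) = m * u k"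
    using left_eigenvector[of 3 B] by auto
  let ?A = "\<lambda>j k. A j k - (if k = j then l else 0)" and ?B = "\<lambda>j k. B j k - (if k = j then m else 0)"
  have sh: "lform 3 (\<lambda>k. C j k - (if k = j then c else 0)) z = lform 3 (C j) z - c * z j" if "j < 3" for C and c :: complex and j :: nat and z
    using that by (simp add: lform_def left_diff_distrib sum_subtractf if_distrib[of "\<lambda>x. x * _"] cong: if_cong)
  have ev: "(\<Sum>j<3. x j * (C j k - (if k = j then c else 0))) = (\<Sum>j<3. x j * C j k) - c * x k" if "k < 3" for C and c :: complex and x and k :: nat
    using that by (simp add: right_diff_distrib sum_subtractf if_distrib[of "\<lambda>y. _ * y"] cong: if_cong)
  have "\<exists>\<alpha> \<beta>. \<forall>z. g z - l * f1 z - m * f2 z = \<alpha> * f1 z + \<beta> * f2 z"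
  proof (rule linear_syzygy_three_normalized[where A = ?A and B = ?B and w = w and u = u])
    show "polyfun (\<lambda>z. g z - l * f1 z - m * f2 z)"
      by (intro polyfun_diff polyfun_mult polyfun_const f1 f2 g)
    show "z j * (g z - l * f1 z - m * f2 z) = lform 3 (?A j) z * f1 z + lform 3 (?B j) z * f2 z" if "j < 3" for z j
      unfolding sh[OF that] using eq[OF that, of z] by (simp add: algebra_simps)
  qed (use f1 f2 w u ev in auto)
  then obtain \<alpha> \<beta> where "\<And>z. g z - l * f1 z - m * f2 z = \<alpha> * f1 z + \<beta> * f2 z" by auto
  then have "\<forall>z. g z = (\<alpha> + l) * f1 z + (\<beta> + m) * f2 z" by (simp add: algebra_simps)
  then show ?thesis by blast
qed

section \<open>Unitary diagonalization and eigenvalue counts\<close>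

definition adj :: "complex mat \<Rightarrow> complex mat" where
  "adj A = mat (dim_col A) (dim_row A) (\<lambda>(i, j). cnj (A $$ (j, i)))"

definition diag_of :: "nat \<Rightarrow> (nat \<Rightarrow> real) \<Rightarrow> complex mat" where
  "diag_of n d = mat n n (\<lambda>(i, j). if i = j then complex_of_real (d i) else 0)"

lemma adj_carrier [simp, intro]: "A \<in> carrier_mat m n \<Longrightarrow> adj A \<in> carrier_mat n m"
  by (auto simp: adj_def)

lemma diag_of_carrier [simp, intro]: "diag_of n d \<in> carrier_mat n n"
  by (simp add: diag_of_def)

lemma adj_mult:
  assumes "A \<in> carrier_mat l m" "B \<in> carrier_mat m n"
  shows "adj (A * B) = adj B * adj A"
  by (rule eq_matI) (use assms in \<open>auto simp: adj_def scalar_prod_def mult.commute\<close>)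

lemma adj_adj: "adj (adj A) = A"
  by (rule eq_matI) (auto simp: adj_def)

lemma adj_four_block:
  assumes "A \<in> carrier_mat m n" "B \<in> carrier_mat m n'" "C \<in> carrier_mat m' n" "D \<in> carrier_mat m' n'"
  shows "adj (four_block_mat A B C D) = four_block_mat (adj A) (adj C) (adj B) (adj D)"
  by (rule eq_matI) (use assms in \<open>auto simp: adj_def\<close>)

lemma mult_block_diag:
  assumes "A \<in> carrier_mat k k" "A' \<in> carrier_mat k k" "B \<in> carrier_mat n n" "B' \<in> carrier_mat n n"
  shows "four_block_mat A (0\<^sub>m k n) (0\<^sub>m n k) B * four_block_mat A' (0\<^sub>m k n) (0\<^sub>m n k) B'
    = four_block_mat (A * A') (0\<^sub>m k n) (0\<^sub>m n k) (B * B' :: 'a :: comm_ring_1 mat)"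
  using assms by (subst mult_four_block_mat[of _ k k _ n _ n _ _ k _ n])
    (auto simp: right_mult_zero_mat[of _ _ n] right_mult_zero_mat[of _ _ k])

lemma unitary_conj_comp:
  assumes "W \<in> carrier_mat n n" "V \<in> carrier_mat n n" "A \<in> carrier_mat n n"
  shows "adj (W * V) * A * (W * V) = adj V * (adj W * A * W) * V"
proof -
  note [simp] = assoc_mult_mat[of _ n n _ n _ n] mult_carrier_mat[of _ n n _ n] adj_mult[OF assms(1,2)]
  have [simp]: "adj W \<in> carrier_mat n n" "adj V \<in> carrier_mat n n" using assms by auto
  show ?thesis using assms by simp
qed

text \<open>Complete \<open>v\<close> to a basis and apply Gram-Schmidt, which keeps the first
  vector; dividing by the norms \<open>s i\<close> gives the columns of \<open>W\<close>, so
  \<open>r\<close> is the inverse norm of \<open>v\<close>.\<close>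

lemma unitary_first_column:
  fixes v :: "complex vec"
  assumes v: "v \<in> carrier_vec n" "v \<noteq> 0\<^sub>v n"
  obtains W r where "W \<in> carrier_mat n n" "adj W * W = 1\<^sub>m n" "col W 0 = r \<cdot>\<^sub>v v"
proof -
  have n: "n \<noteq> 0"
  proof
    assume "n = 0"
    then show False using v by auto
  qed
  interpret cof_vec_space n "TYPE(complex)" .
  define b where "b = basis_completion v"
  define ws where "ws = gram_schmidt n b"
  from basis_completion[OF v, folded b_def]
  have dist_b: "distinct b" and indep: "\<not> lin_dep (set b)" and b: "set b \<subseteq> carrier_vec n"
    and len_b: "length b = n" by auto
  have hdb: "hd b = v" by (simp add: b_def basis_completion_def Let_def)
  from hdb len_b n obtain vs where bv: "b = v # vs" by (cases b, auto)
  from gram_schmidt_result[OF b dist_b indep refl, folded ws_def]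
  have ws: "set ws \<subseteq> carrier_vec n" "corthogonal ws" "length ws = n"
    by (auto simp: len_b)
  have hdws: "hd ws = v" using gram_schmidt_hd[OF v(1), of vs, folded bv] unfolding ws_def .
  have wsc: "ws ! i \<in> carrier_vec n" if "i < n" for i using ws that by auto
  define s where "s i = sqrt (\<Sum>k<n. (cmod ((ws ! i) $ k))\<^sup>2)" for i
  have sp: "ws ! i \<bullet>c ws ! j = (\<Sum>k<n. (ws ! i) $ k * cnj ((ws ! j) $ k))" if "i < n" "j < n" for i j
    using wsc[OF that(1)] wsc[OF that(2)] by (auto simp: scalar_prod_def lessThan_atLeast0)
  have ss: "complex_of_real (s i * s i) = ws ! i \<bullet>c ws ! i" if "i < n" for i
    unfolding sp[OF that that] s_def by (simp add: sum_nonneg complex_norm_square del: of_real_power)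
  have s0: "s i \<noteq> 0" if "i < n" for i
    using ss[OF that] corthogonalD[OF ws(2), of i i] that ws(3) by auto
  define W where "W = mat n n (\<lambda>(k, i). (ws ! i) $ k / complex_of_real (s i))"
  have W: "W \<in> carrier_mat n n" by (simp add: W_def)
  have "adj W * W = 1\<^sub>m n"
  proof (rule eq_matI)
    fix i j assume "i < dim_row (1\<^sub>m n :: complex mat)" "j < dim_col (1\<^sub>m n :: complex mat)"
    then have ij: "i < n" "j < n" by auto
    have "(adj W * W) $$ (i, j) = (\<Sum>k<n. (ws ! j) $ k * cnj ((ws ! i) $ k) / (complex_of_real (s i) * complex_of_real (s j)))"
      using ij by (auto simp: adj_def W_def scalar_prod_def lessThan_atLeast0 mult.commute intro!: sum.cong)
    also have "\<dots> = (ws ! j \<bullet>c ws ! i) / (complex_of_real (s i) * complex_of_real (s j))"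
      unfolding sp[OF ij(2,1)] sum_divide_distrib ..
    also have "\<dots> = (if i = j then 1 else 0)"
      using ss[OF ij(1)] s0[OF ij(1)] corthogonalD[OF ws(2), of j i] ij ws(3) by (auto simp flip: of_real_mult)
    finally show "(adj W * W) $$ (i, j) = 1\<^sub>m n $$ (i, j)" using ij by simp
  qed (use W in \<open>auto simp: adj_def\<close>)
  moreover have "col W 0 = (1 / complex_of_real (s 0)) \<cdot>\<^sub>v v"
  proof -
    have "ws ! 0 = v" using n hdws ws(3) by (cases ws) auto
    then show ?thesis using n v by (intro eq_vecI) (auto simp: W_def)
  qed
  ultimately show thesis using W that by blast
qed

text \<open>Induction on the size. If the first column of the unitary \<open>W\<close> is an
  eigenvector, the first column of \<open>adj W * A * W\<close> is a multiple of the first unit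
  vector; Hermitian symmetry clears the first row, and the remaining block is again
  Hermitian.\<close>

theorem hermitian_diagonalization:
  assumes "A \<in> carrier_mat n n" "adj A = A"
  shows "\<exists>U d. U \<in> carrier_mat n n \<and> adj U * U = 1\<^sub>m n \<and> adj U * A * U = diag_of n d"
  using assms
proof (induction n arbitrary: A)
  case 0
  then show ?case
    by (intro exI[of _ "1\<^sub>m 0"] exI[of _ "\<lambda>_. 0"]) (auto simp: adj_def diag_of_def intro!: eq_matI)
next
  case (Suc n)
  note A = Suc.prems(1)
  let ?N = "Suc n"
  obtain e where "eigenvalue A e" using spectrum_non_empty[OF A] by (auto simp: spectrum_def)
  then obtain v where v: "v \<in> carrier_vec ?N" "v \<noteq> 0\<^sub>v ?N" "A *\<^sub>v v = e \<cdot>\<^sub>v v"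
    using A unfolding eigenvalue_def eigenvector_def by auto
  obtain W r where W: "W \<in> carrier_mat ?N ?N" and WW: "adj W * W = 1\<^sub>m ?N" and col0: "col W 0 = r \<cdot>\<^sub>v v"
    using unitary_first_column[OF v(1,2)] by metis
  define B where "B = adj W * A * W"
  have aW: "adj W \<in> carrier_mat ?N ?N" using W by auto
  have B: "B \<in> carrier_mat ?N ?N" unfolding B_def by (intro mult_carrier_mat[of _ ?N ?N] aW A W)
  have aB: "adj B = B"
    unfolding B_def adj_mult[OF mult_carrier_mat[OF aW A] W] adj_mult[OF aW A] adj_adj Suc.prems(2)
    by (rule assoc_mult_mat[OF aW A W, symmetric])
  have herm: "B $$ (i, j) = cnj (B $$ (j, i))" if "i < ?N" "j < ?N" for i j
    using arg_cong[OF aB, of "\<lambda>M. M $$ (i, j)"] that B by (simp add: adj_def)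
  have B0: "B $$ (i, 0) = (if i = 0 then e else 0)" if "i < ?N" for i
  proof -
    have "A *\<^sub>v col W 0 = e \<cdot>\<^sub>v col W 0"
      unfolding col0 using A v by (auto simp: mult_mat_vec smult_smult_assoc mult.commute)
    then have cAW: "col (A * W) 0 = e \<cdot>\<^sub>v col W 0"
      using col_mult2[OF A W, of 0] by simp
    have "col B 0 = adj W *\<^sub>v (e \<cdot>\<^sub>v col W 0)"
      unfolding B_def assoc_mult_mat[OF aW A W] cAW[symmetric]
      by (rule col_mult2[OF aW mult_carrier_mat[OF A W]]) simp
    also have "\<dots> = e \<cdot>\<^sub>v col (adj W * W) 0"
      using mult_mat_vec[OF aW, of "col W 0" e] col_mult2[OF aW W, of 0] col_dim[of W 0] W by auto
    finally have "col B 0 $ i = (e \<cdot>\<^sub>v col (1\<^sub>m ?N) 0) $ i" unfolding WW by simp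
    then show ?thesis using that B by simp
  qed
  have e_real: "e = complex_of_real (Re e)"
    using herm[of 0 0] B0[of 0] by (simp add: complex_eq_iff)
  define C where "C = mat n n (\<lambda>(i, j). B $$ (Suc i, Suc j))"
  have C: "C \<in> carrier_mat n n" by (simp add: C_def)
  have "adj C = C" by (rule eq_matI) (auto simp: adj_def C_def intro!: herm[symmetric])
  from Suc.IH[OF C this] obtain V d where V: "V \<in> carrier_mat n n" "adj V * V = 1\<^sub>m n" "adj V * C * V = diag_of n d"
    by auto
  define E where "E = mat 1 1 (\<lambda>_. e)"
  have Bblock: "B = four_block_mat E (0\<^sub>m 1 n) (0\<^sub>m n 1) C"
  proof (rule eq_matI)
    fix i j assume "i < dim_row (four_block_mat E (0\<^sub>m 1 n) (0\<^sub>m n 1) C)" "j < dim_col (four_block_mat E (0\<^sub>m 1 n) (0\<^sub>m n 1) C)"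
    then have ij: "i < ?N" "j < ?N" by (auto simp: E_def C_def)
    show "B $$ (i, j) = four_block_mat E (0\<^sub>m 1 n) (0\<^sub>m n 1) C $$ (i, j)"
    proof (cases "j = 0 \<or> i \<noteq> 0")
      case True
      then show ?thesis using B0[of i] ij by (auto simp: E_def C_def)
    next
      case False
      then show ?thesis using B0[of j] herm[of 0 j] ij by (cases j) (auto simp: E_def C_def)
    qed
  qed (use B in \<open>auto simp: E_def C_def\<close>)
  define V1 where "V1 = four_block_mat (1\<^sub>m 1) (0\<^sub>m 1 n) (0\<^sub>m n 1) V"
  have E: "E \<in> carrier_mat 1 1" by (simp add: E_def)
  have aV: "adj V \<in> carrier_mat n n" using V by auto
  have a0: "adj (0\<^sub>m k l) = 0\<^sub>m l k" and a1: "adj (1\<^sub>m k) = 1\<^sub>m k" for k l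
    by (auto simp: adj_def intro!: eq_matI)
  have aV1: "adj V1 = four_block_mat (1\<^sub>m 1) (0\<^sub>m 1 n) (0\<^sub>m n 1) (adj V)"
    unfolding V1_def using V by (subst adj_four_block[of _ 1 1 _ n _ n]) (auto simp: a0 a1)
  have V1: "V1 \<in> carrier_mat ?N ?N" using V by (auto simp: V1_def)
  have uV1: "adj V1 * V1 = 1\<^sub>m ?N"
    unfolding aV1 unfolding V1_def mult_block_diag[OF one_carrier_mat one_carrier_mat aV V(1)] V(2)
    by (simp add: four_block_one_mat)
  have dV1: "adj V1 * B * V1 = four_block_mat E (0\<^sub>m 1 n) (0\<^sub>m n 1) (diag_of n d)"
    unfolding aV1 Bblock mult_block_diag[OF one_carrier_mat E aV C] unfolding V1_def
    using E by (simp add: mult_block_diag[OF _ one_carrier_mat _ V(1)] mult_carrier_mat[OF aV C] V(3)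
        del: One_nat_def)
  show ?case
  proof (intro exI conjI)
    show "W * V1 \<in> carrier_mat ?N ?N" using W V1 by auto
    have "adj (W * V1) * (W * V1) = adj V1 * (adj W * W) * V1"
      using unitary_conj_comp[OF W V1 one_carrier_mat]
      by (simp add: right_mult_one_mat[OF adj_carrier[OF mult_carrier_mat[OF W V1]]] right_mult_one_mat[OF aW])
    then show "adj (W * V1) * (W * V1) = 1\<^sub>m ?N"
      unfolding WW by (simp add: right_mult_one_mat[OF adj_carrier[OF V1]] uV1)
    have "four_block_mat E (0\<^sub>m 1 n) (0\<^sub>m n 1) (diag_of n d) = diag_of ?N (case_nat (Re e) d)"
      using e_real by (intro eq_matI) (auto simp: diag_of_def E_def split: nat.split)
    then show "adj (W * V1) * A * (W * V1) = diag_of ?N (case_nat (Re e) d)"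
      unfolding unitary_conj_comp[OF W V1 A] B_def[symmetric] dV1 .
  qed
qed

lemma unitary_similar:
  assumes A: "A \<in> carrier_mat n n" and U: "U \<in> carrier_mat n n" "adj U * U = 1\<^sub>m n"
    and D: "adj U * A * U = diag_of n d"
  shows "A = U * diag_of n d * adj U" "char_poly A = (\<Prod>i<n. [:- complex_of_real (d i), 1:])"
proof -
  have aU: "adj U \<in> carrier_mat n n" using U by auto
  have UU: "U * adj U = 1\<^sub>m n" using mat_mult_left_right_inverse[OF aU U] .
  have "U * (adj U * A * U) * adj U = (U * adj U) * A * (U * adj U)"
    using A U aU by (simp add: assoc_mult_mat[of _ n n _ n _ n] mult_carrier_mat[of _ n n _ n])
  then show eq: "A = U * diag_of n d * adj U" using A by (simp add: D UU)
  have "similar_mat A (diag_of n d)"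
    by (rule similar_matI[OF _ UU U(2) eq]) (use A U aU in auto)
  then have "char_poly A = char_poly (diag_of n d)" by (rule char_poly_similar)
  also have "\<dots> = (\<Prod>a\<leftarrow>diag_mat (diag_of n d). [:- a, 1:])"
    by (rule char_poly_upper_triangular[OF diag_of_carrier]) (auto simp: diag_of_def)
  also have "diag_mat (diag_of n d) = map (\<lambda>i. complex_of_real (d i)) [0..<n]"
    by (auto simp: diag_mat_def diag_of_def)
  finally show "char_poly A = (\<Prod>i<n. [:- complex_of_real (d i), 1:])"
    using prod.distinct_set_conv_list[of "[0..<n]" "\<lambda>i. [:- complex_of_real (d i), 1:]"]
    by (simp add: comp_def lessThan_atLeast0)
qed

section \<open>Counting eigenvalues by sign\<close>

lemma order_prod_linear:
  "finite I \<Longrightarrow> order x (\<Prod>i\<in>I. [:- complex_of_real (d i), 1:]) = card {i\<in>I. complex_of_real (d i) = x}"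
proof (induction I rule: finite_induct)
  case (insert i I)
  have nz: "(\<Prod>i\<in>I. [:- complex_of_real (d i), 1:]) \<noteq> 0" using insert.hyps by simp
  have "order x [:- complex_of_real (d i), 1:] = (if complex_of_real (d i) = x then 1 else 0)"
  proof (cases "complex_of_real (d i) = x")
    case True
    then show ?thesis using order_power_n_n[of x 1] by simp
  next
    case False
    then show ?thesis by (auto intro: order_0I)
  qed
  moreover have "{j\<in>insert i I. complex_of_real (d j) = x} =
      (if complex_of_real (d i) = x then insert i {j\<in>I. complex_of_real (d j) = x} else {j\<in>I. complex_of_real (d j) = x})"
    by auto
  moreover have "order x (\<Prod>j\<in>insert i I. [:- complex_of_real (d j), 1:])
      = order x [:- complex_of_real (d i), 1:] + order x (\<Prod>j\<in>I. [:- complex_of_real (d j), 1:])"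
    unfolding prod.insert[OF insert.hyps(1,2)] by (rule order_mult) (use nz in \<open>simp del: mult_pCons_left\<close>)
  ultimately show ?case using insert by simp
qed simp

text \<open>The order of a root is the number of indices at which \<open>d\<close> takes that value,
  so summing orders over the roots of one sign counts indices.\<close>

lemma num_eig:
  fixes n :: nat
  assumes p: "char_poly A = (\<Prod>i<n. [:- complex_of_real (d i), 1:])"
  shows "num_pos_eig A = card {i. i < n \<and> d i > 0}" "num_neg_eig A = card {i. i < n \<and> d i < 0}"
proof -
  have gen: "(\<Sum>x\<in>{x. Im x = 0 \<and> Q (Re x) \<and> poly (char_poly A) x = 0}. order x (char_poly A))
      = card {i. i < n \<and> Q (d i)}" for Q
  proof -
    have set: "{x. Im x = 0 \<and> Q (Re x) \<and> poly (char_poly A) x = 0} = (\<lambda>i. complex_of_real (d i)) ` {i. i < n \<and> Q (d i)}"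
    proof -
      have "poly (char_poly A) x = 0 \<longleftrightarrow> (\<exists>i<n. x = complex_of_real (d i))" for x
        by (auto simp: p poly_prod)
      then show ?thesis by (auto simp: image_iff complex_eq_iff)
    qed
    have "card {i. i < n \<and> Q (d i)} = (\<Sum>x\<in>(\<lambda>i. complex_of_real (d i)) ` {i. i < n \<and> Q (d i)}.
        card {i\<in>{i. i < n \<and> Q (d i)}. complex_of_real (d i) = x})"
      using sum.image_gen[of "{i. i < n \<and> Q (d i)}" "\<lambda>_. 1::nat" "\<lambda>i. complex_of_real (d i)"] by simp
    also have "\<dots> = (\<Sum>x\<in>(\<lambda>i. complex_of_real (d i)) ` {i. i < n \<and> Q (d i)}. order x (char_poly A))"
      unfolding p order_prod_linear[OF finite_lessThan]
      by (intro sum.cong arg_cong[of _ _ card]) auto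
    finally show ?thesis unfolding set by simp
  qed
  show "num_pos_eig A = card {i. i < n \<and> d i > 0}" "num_neg_eig A = card {i. i < n \<and> d i < 0}"
    unfolding num_pos_eig_def num_neg_eig_def by (rule gen)+
qed

section \<open>The lower bound in at most three variables\<close>

lemma set_mis: "set (mis n m) = {l. length l = n \<and> sum_list l = m}"
proof (induction n arbitrary: m)
  case (Suc n)
  show ?case
  proof (rule Set.set_eqI)
    fix l :: "nat list"
    show "l \<in> set (mis (Suc n) m) \<longleftrightarrow> l \<in> {l. length l = Suc n \<and> sum_list l = m}"
      by (cases l) (auto simp: Suc.IH image_iff simp del: upt_Suc)
  qed
qed auto

lemma distinct_mis: "distinct (mis n m)"
proof (induction n arbitrary: m)
  case (Suc n)
  have "distinct (concat (map (\<lambda>k. map (\<lambda>l. k # l) (mis n (m - k))) ks))" if "distinct ks" for ks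
    using that by (induction ks) (auto simp: distinct_map Suc.IH)
  then show ?case by (simp del: upt_Suc)
qed auto

lemma mono_Cons: "mono z (k # l) = z 0 ^ k * mono (\<lambda>j. z (Suc j)) l"
  unfolding mono_def length_Cons prod.lessThan_Suc_shift by simp

text \<open>Induction on the number of variables: with the other variables fixed, the sum is a
  polynomial in the first one. Its coefficients vanish, and they are combinations of monomials in
  one variable fewer.\<close>

lemma mono_independent:
  assumes "finite S" "\<forall>\<alpha>\<in>S. length \<alpha> = n" "\<forall>z. (\<Sum>\<alpha>\<in>S. a \<alpha> * mono z \<alpha>) = 0" "\<alpha> \<in> S"
  shows "a \<alpha> = 0"
  using assms
proof (induction n arbitrary: S a \<alpha>)
  case 0
  then have "S = {[]}" by auto
  then show ?case using "0.prems" by (auto simp: mono_def)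
next
  case (Suc n)
  obtain k l where kl: "\<alpha> = k # l" using Suc.prems by (cases \<alpha>) auto
  define Sk where "Sk i = {l. i # l \<in> S}" for i
  have fin: "finite (Sk i)" for i
    by (rule finite_subset[of _ "tl ` S"]) (use Suc.prems(1) in \<open>force simp: Sk_def image_iff\<close>)+
  define M where "M = Max (hd ` S)"
  have M: "hd \<beta> \<le> M" if "\<beta> \<in> S" for \<beta> using that Suc.prems(1) by (simp add: M_def)
  have S: "S = (\<lambda>(i, l). i # l) ` (SIGMA i:{..M}. Sk i)"
  proof (intro Set.set_eqI iffI)
    fix \<beta> assume b: "\<beta> \<in> S"
    then obtain i l where "\<beta> = i # l" using Suc.prems(2) by (cases \<beta>) auto
    then show "\<beta> \<in> (\<lambda>(i, l). i # l) ` (SIGMA i:{..M}. Sk i)" using M[OF b] b by (force simp: Sk_def)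
  qed (auto simp: Sk_def)
  have "(\<Sum>l\<in>Sk k. a (k # l) * mono z l) = 0" for z
  proof -
    have "(\<Sum>i\<le>M. (\<Sum>l\<in>Sk i. a (i # l) * mono z l) * t ^ i) = 0" for t
    proof -
      have "0 = (\<Sum>\<alpha>\<in>S. a \<alpha> * mono (case_nat t z) \<alpha>)" using Suc.prems(3) by simp
      also have "\<dots> = (\<Sum>(i, l)\<in>(SIGMA i:{..M}. Sk i). a (i # l) * mono (case_nat t z) (i # l))"
        by (subst S, subst sum.reindex) (auto simp: inj_on_def case_prod_unfold)
      also have "\<dots> = (\<Sum>i\<le>M. \<Sum>l\<in>Sk i. a (i # l) * (t ^ i * mono z l))"
        using fin by (simp add: sum.Sigma mono_Cons)
      finally show ?thesis by (simp add: sum_distrib_left sum_distrib_right ac_simps)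
    qed
    then have "\<forall>i\<le>M. (\<Sum>l\<in>Sk i. a (i # l) * mono z l) = 0" by (subst polyfun_eq_0[symmetric]) auto
    moreover have "k \<le> M" using M[OF Suc.prems(4)] kl by simp
    ultimately show ?thesis by auto
  qed
  then have sums: "\<forall>z. (\<Sum>l\<in>Sk k. a (k # l) * mono z l) = 0" by blast
  have len: "\<forall>l\<in>Sk k. length l = n" using Suc.prems(2) unfolding Sk_def by force
  have "l \<in> Sk k" using Suc.prems(4) kl by (simp add: Sk_def)
  then show ?case
    using Suc.IH[OF fin len sums] by (simp add: kl)
qed

section \<open>Diagonal form of a Hermitian polynomial\<close>

lemma sum_mis: "(\<Sum>\<alpha>\<in>set (mis n m). f \<alpha>) = (\<Sum>i<length (mis n m). f (mis n m ! i))"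
  using sum.reindex_bij_betw[OF bij_betw_nth[OF distinct_mis refl refl], of f] by simp

lemma mult_mat_entry:
  assumes "X \<in> carrier_mat n n" "Y \<in> carrier_mat n n" "i < n" "j < n"
  shows "(X * Y) $$ (i, j) = (\<Sum>k<n. X $$ (i, k) * Y $$ (k, j))"
  using assms by (auto simp: scalar_prod_def lessThan_atLeast0)

text \<open>The \<open>F k\<close> are the columns of the diagonalizing unitary matrix read as
  polynomials; they inherit independence from the monomials because that matrix is
  invertible.\<close>

lemma diagonal_form:
  assumes "hermitian_coeffs n m c"
  obtains N :: nat and d :: "nat \<Rightarrow> real" and F where "\<And>k. polyfun (F k)"
    "\<And>z. bihom n m c z = (\<Sum>k<N. complex_of_real (d k) * (F k z * cnj (F k z)))"
    "\<And>b k. (\<forall>z. (\<Sum>k<N. b k * F k z) = 0) \<Longrightarrow> k < N \<Longrightarrow> b k = 0"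
    "signature n m c = (card {k. k < N \<and> d k > 0}, card {k. k < N \<and> d k < 0})"
proof -
  define N where "N = length (mis n m)"
  define A where "A = coeff_mat n m c"
  have A: "A \<in> carrier_mat N N" by (simp add: A_def coeff_mat_def N_def)
  have "adj A = A"
  proof (rule eq_matI)
    fix i j assume ij: "i < dim_row A" "j < dim_col A"
    then have "mis n m ! i \<in> set (mis n m)" "mis n m ! j \<in> set (mis n m)"
      by (auto simp: A_def coeff_mat_def)
    then have "c (mis n m ! i) (mis n m ! j) = cnj (c (mis n m ! j) (mis n m ! i))"
      using assms unfolding hermitian_coeffs_def by blast
    then show "adj A $$ (i, j) = A $$ (i, j)" using ij by (simp add: adj_def A_def coeff_mat_def)
  qed (auto simp: adj_def A_def coeff_mat_def)
  with hermitian_diagonalization[OF A] obtain U d where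
    U: "U \<in> carrier_mat N N" "adj U * U = 1\<^sub>m N" "adj U * A * U = diag_of N d" by auto
  note sim = unitary_similar[OF A U]
  define F where "F k z = (\<Sum>i<N. U $$ (i, k) * mono z (mis n m ! i))" for k z
  have Aij: "A $$ (i, j) = (\<Sum>k<N. U $$ (i, k) * complex_of_real (d k) * cnj (U $$ (j, k)))" if "i < N" "j < N" for i j
  proof -
    have UD: "(U * diag_of N d) $$ (i, k) = U $$ (i, k) * complex_of_real (d k)" if "k < N" for k
    proof -
      have "(U * diag_of N d) $$ (i, k) = (\<Sum>l<N. if l = k then U $$ (i, l) * complex_of_real (d l) else 0)"
        using U(1) \<open>i < N\<close> that
        by (auto simp: diag_of_def scalar_prod_def lessThan_atLeast0 if_distrib[of "\<lambda>x. _ * x"] cong: if_cong)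
      then show ?thesis using that by simp
    qed
    have "A $$ (i, j) = (\<Sum>k<N. (U * diag_of N d) $$ (i, k) * adj U $$ (k, j))"
      unfolding arg_cong[OF sim(1), of "\<lambda>M. M $$ (i, j)"]
      by (rule mult_mat_entry[OF mult_carrier_mat[OF U(1) diag_of_carrier] adj_carrier[OF U(1)] that])
    also have "\<dots> = (\<Sum>k<N. U $$ (i, k) * complex_of_real (d k) * cnj (U $$ (j, k)))"
      using U(1) that by (intro sum.cong) (simp_all add: UD adj_def)
    finally show ?thesis .
  qed
  have pF: "polyfun (F k)" for k
    unfolding F_def[abs_def] by (intro polyfun_sum polyfun_mult polyfun_const polyfun_mono)
  have bi: "bihom n m c z = (\<Sum>k<N. complex_of_real (d k) * (F k z * cnj (F k z)))" for z
  proof -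
    let ?\<mu> = "\<lambda>i. mono z (mis n m ! i)"
    have FF: "F k z * cnj (F k z) = (\<Sum>i<N. \<Sum>j<N. (U $$ (i, k) * ?\<mu> i) * cnj (U $$ (j, k) * ?\<mu> j))" for k
      unfolding F_def cnj_sum sum_product ..
    have "bihom n m c z = (\<Sum>i<N. \<Sum>j<N. A $$ (i, j) * ?\<mu> i * cnj (?\<mu> j))"
      unfolding bihom_def sum_mis N_def by (simp add: A_def coeff_mat_def)
    also have "\<dots> = (\<Sum>i<N. \<Sum>j<N. \<Sum>k<N. complex_of_real (d k) * ((U $$ (i, k) * ?\<mu> i) * cnj (U $$ (j, k) * ?\<mu> j)))"
      by (intro sum.cong refl) (simp add: Aij sum_distrib_left sum_distrib_right ac_simps)
    also have "\<dots> = (\<Sum>i<N. \<Sum>k<N. \<Sum>j<N. complex_of_real (d k) * ((U $$ (i, k) * ?\<mu> i) * cnj (U $$ (j, k) * ?\<mu> j)))"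
      by (intro sum.cong refl sum.swap)
    also have "\<dots> = (\<Sum>k<N. \<Sum>i<N. \<Sum>j<N. complex_of_real (d k) * ((U $$ (i, k) * ?\<mu> i) * cnj (U $$ (j, k) * ?\<mu> j)))"
      by (rule sum.swap)
    also have "\<dots> = (\<Sum>k<N. complex_of_real (d k) * (F k z * cnj (F k z)))"
      by (simp only: FF sum_distrib_left)
    finally show ?thesis .
  qed
  have sg: "signature n m c = (card {k. k < N \<and> d k > 0}, card {k. k < N \<and> d k < 0})"
    unfolding signature_def A_def[symmetric] using num_eig[OF sim(2)] by simp
  have ind: "b k = 0" if b: "\<forall>z. (\<Sum>k<N. b k * F k z) = 0" and k: "k < N" for b k
  proof -
    have "(\<Sum>l<N. U $$ (i, l) * b l) = 0" if i: "i < N" for i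
    proof -
      \<comment> \<open>\<open>mono_independent\<close> takes coefficients indexed by exponents,
        while matrix rows are numbered; \<open>idx\<close> recovers the row of an exponent.\<close>
      define idx where "idx \<alpha> = (THE i. i < N \<and> mis n m ! i = \<alpha>)" for \<alpha>
      have idx: "idx (mis n m ! i) = i" if "i < N" for i
        unfolding idx_def using that distinct_mis[of n m] by (auto simp: N_def nth_eq_iff_index_eq)
      have "(\<Sum>\<alpha>\<in>set (mis n m). (\<Sum>l<N. U $$ (idx \<alpha>, l) * b l) * mono z \<alpha>) = 0" for z
      proof -
        have "0 = (\<Sum>l<N. \<Sum>i<N. b l * (U $$ (i, l) * mono z (mis n m ! i)))"
          using b by (simp add: F_def sum_distrib_left)
        also have "\<dots> = (\<Sum>i<N. \<Sum>l<N. b l * (U $$ (i, l) * mono z (mis n m ! i)))"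
          by (rule sum.swap)
        also have "\<dots> = (\<Sum>i<N. (\<Sum>l<N. U $$ (i, l) * b l) * mono z (mis n m ! i))"
          unfolding sum_distrib_right by (intro sum.cong refl) (simp add: ac_simps)
        finally show ?thesis unfolding sum_mis N_def[symmetric] by (simp add: idx)
      qed
      then have all: "\<forall>z. (\<Sum>\<alpha>\<in>set (mis n m). (\<Sum>l<N. U $$ (idx \<alpha>, l) * b l) * mono z \<alpha>) = 0"
        by blast
      have len: "\<forall>\<alpha>\<in>set (mis n m). length \<alpha> = n" by (simp add: set_mis)
      have "mis n m ! i \<in> set (mis n m)" using i by (simp add: N_def)
      from mono_independent[OF finite_set len all this] show ?thesis using idx[OF i] by simp
    qed note zero = this
    \<comment> \<open>The columns are orthonormal, so multiplying the zero vector \<open>U b\<close>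
      by \<open>adj U\<close> returns \<open>b\<close>.\<close>
    have one: "(\<Sum>i<N. cnj (U $$ (i, k)) * U $$ (i, l)) = (if k = l then 1 else 0)" if "l < N" for l
      using arg_cong[OF U(2), of "\<lambda>M. M $$ (k, l)"] U(1) that k
      by (simp add: adj_def scalar_prod_def lessThan_atLeast0)
    have "b k = (\<Sum>l<N. (if k = l then 1 else 0) * b l)" using k by (simp add: if_distrib[of "\<lambda>x. x * _"] cong: if_cong)
    also have "\<dots> = (\<Sum>l<N. \<Sum>i<N. cnj (U $$ (i, k)) * (U $$ (i, l) * b l))"
      by (intro sum.cong refl) (simp add: one[symmetric] sum_distrib_right mult.assoc)
    also have "\<dots> = (\<Sum>i<N. cnj (U $$ (i, k)) * (\<Sum>l<N. U $$ (i, l) * b l))"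
      by (subst sum.swap) (simp add: sum_distrib_left)
    also have "\<dots> = 0" by (simp add: zero)
    finally show ?thesis .
  qed
  show thesis by (rule that[of F d N, OF pF bi _ sg]) (rule ind)
qed

section \<open>Positivity and the multiplier relation\<close>

lemma norm_functional:
  "(\<Sum>x\<in>T. \<Sum>y\<in>T. (a x * cnj (a y)) * (f x * cnj (f y))) = complex_of_real ((cmod (\<Sum>x\<in>T. a x * f x))\<^sup>2)"
  unfolding complex_norm_square cnj_sum sum_product by (simp add: ac_simps)

text \<open>Otherwise a finite combination of evaluations kills all \<open>z j * F k z\<close> with
  \<open>d k > 0\<close> but not \<open>z j0 * F q z\<close>. Applied to both variables of the
  polarized identity, conjugated in the second, it makes the left side negative, while the right
  side becomes a sum of squared moduli.\<close>

lemma multiplier_span: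
  fixes F :: "nat \<Rightarrow> (nat \<Rightarrow> complex) \<Rightarrow> complex" and d :: "nat \<Rightarrow> real"
  assumes F: "\<And>k. polyfun (F k)"
    and sn: "squared_norm n (\<lambda>z. (\<Sum>k<N. complex_of_real (d k) * (F k z * cnj (F k z))) * normsq n z)"
    and q: "q < N" "d q < 0" "\<And>k. k < N \<Longrightarrow> d k < 0 \<Longrightarrow> k = q" and j0: "j0 < n"
  shows "\<exists>a. \<forall>z. z j0 * F q z = (\<Sum>k\<in>{k. k < N \<and> d k > 0}. lform n (a k) z * F k z)"
proof -
  let ?Pos = "{k. k < N \<and> d k > 0}"
  let ?I = "?Pos \<times> {..<n}"
  obtain \<rho> :: nat and h where h: "\<And>k. k < \<rho> \<Longrightarrow> holo_poly n (h k)"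
    and hs: "\<And>z. (\<Sum>k<N. complex_of_real (d k) * (F k z * cnj (F k z))) * normsq n z
      = complex_of_real (\<Sum>k<\<rho>. (cmod (h k z))\<^sup>2)"
    using sn unfolding squared_norm_def by blast
  \<comment> \<open>The polarized difference of the two sides: \<open>Inl\<close> carries
    \<open>z\<close>, and \<open>Inr\<close> an independent variable in place of its
    conjugate.\<close>
  define K where "K = (\<lambda>u. (\<Sum>k<N. \<Sum>j<n. complex_of_real (d k) *
        ((u (Inl j) * F k (\<lambda>i. u (Inl i))) * (u (Inr j) * cnj (F k (\<lambda>i. cnj (u (Inr i)))))))
      - (\<Sum>k<\<rho>. h k (\<lambda>i. u (Inl i)) * cnj (h k (\<lambda>i. cnj (u (Inr i))))))"
  have "polyfun K"
    unfolding K_def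
    using F polyfun_holo_poly[OF h]
      polyfun_reindex[OF F, of _ Inl] polyfun_reindex[OF polyfun_cnj[OF F], of _ Inr]
      polyfun_reindex[OF polyfun_holo_poly[OF h], of _ Inl]
      polyfun_reindex[OF polyfun_cnj[OF polyfun_holo_poly[OF h]], of _ Inr]
    by (intro polyfun_diff polyfun_sum polyfun_mult polyfun_const polyfun_coord) simp_all
  moreover have "K u = 0" if u: "\<And>i. u (Inr i) = cnj (u (Inl i))" for u
  proof -
    define z where "z i = u (Inl i)" for i
    have "K u = (\<Sum>k<N. complex_of_real (d k) * (F k z * cnj (F k z))) * normsq n z
       - complex_of_real (\<Sum>k<\<rho>. (cmod (h k z))\<^sup>2)"
      unfolding K_def u normsq_def of_real_sum complex_norm_square sum_product
      by (simp add: z_def[abs_def] ac_simps)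
    then show ?thesis using hs[of z] by simp
  qed
  ultimately have K0: "K u = 0" for u using polyfun_polarization by blast
  have "\<not> (\<exists>T a. finite T \<and> T \<subseteq> UNIV \<and> (\<forall>i\<in>?I. (\<Sum>z\<in>T. a z * (z (snd i) * F (fst i) z)) = 0)
      \<and> (\<Sum>z\<in>T. a z * (z j0 * F q z)) \<noteq> 0)"
  proof (intro notI, elim exE conjE)
    fix T :: "(nat \<Rightarrow> complex) set" and a
    assume T: "finite T" and van: "\<forall>i\<in>?I. (\<Sum>z\<in>T. a z * (z (snd i) * F (fst i) z)) = 0"
      and nz: "(\<Sum>z\<in>T. a z * (z j0 * F q z)) \<noteq> 0"
    let ?L = "\<lambda>f. (cmod (\<Sum>z\<in>T. a z * f z))\<^sup>2"
    have Kxy: "K (case_sum x (\<lambda>i. cnj (y i))) = (\<Sum>k<N. \<Sum>j<n. complex_of_real (d k) *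
        ((x j * F k x) * cnj (y j * F k y))) - (\<Sum>k<\<rho>. h k x * cnj (h k y))" for x y
      by (simp add: K_def)
    \<comment> \<open>\<open>S\<close> applies the functional in \<open>x\<close> and its conjugate
      in \<open>y\<close>; \<open>norm_functional\<close> turns \<open>f x * cnj (f y)\<close> into
      a squared modulus.\<close>
    define S where "S E = (\<Sum>x\<in>T. \<Sum>y\<in>T. (a x * cnj (a y)) * E x y)" for E
    have S_sum: "S (\<lambda>x y. \<Sum>k<(l::nat). G k x y) = (\<Sum>k<l. S (G k))" for l and G
    proof -
      have "S (\<lambda>x y. \<Sum>k<l. G k x y) = (\<Sum>x\<in>T. \<Sum>k<l. \<Sum>y\<in>T. (a x * cnj (a y)) * G k x y)"
        unfolding S_def sum_distrib_left by (intro sum.cong refl sum.swap)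
      also have "\<dots> = (\<Sum>k<l. S (G k))" unfolding S_def by (rule sum.swap)
      finally show ?thesis .
    qed
    have S_scale: "S (\<lambda>x y. r * G x y) = r * S G" for r G
      by (simp add: S_def sum_distrib_left mult.left_commute)
    have S_diff: "S (\<lambda>x y. G x y - H x y) = S G - S H" for G H
      by (simp add: S_def right_diff_distrib sum_subtractf)
    have S_norm: "S (\<lambda>x y. f x * cnj (f y)) = complex_of_real (?L f)" for f
      unfolding S_def by (rule norm_functional)
    have "0 = S (\<lambda>x y. K (case_sum x (\<lambda>i. cnj (y i))))"
      by (simp add: K0 S_def)
    also have "\<dots> = (\<Sum>k<N. \<Sum>j<n. complex_of_real (d k) * S (\<lambda>x y. (x j * F k x) * cnj (y j * F k y)))
        - (\<Sum>k<\<rho>. S (\<lambda>x y. h k x * cnj (h k y)))"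
      unfolding Kxy S_diff S_sum S_scale ..
    also have "\<dots> = complex_of_real ((\<Sum>k<N. \<Sum>j<n. d k * ?L (\<lambda>z. z j * F k z)) - (\<Sum>k<\<rho>. ?L (h k)))"
    proof -
      have "S (\<lambda>x y. (x j * F k x) * cnj (y j * F k y)) = complex_of_real (?L (\<lambda>z. z j * F k z))" for j k
        by (rule S_norm)
      then show ?thesis unfolding S_norm of_real_diff of_real_sum of_real_mult by (simp only:)
    qed
    finally have "(\<Sum>k<N. \<Sum>j<n. d k * ?L (\<lambda>z. z j * F k z)) - (\<Sum>k<\<rho>. ?L (h k)) = 0"
      unfolding eq_commute[of "0::complex"] of_real_eq_0_iff .
    then have eq: "(\<Sum>k<N. \<Sum>j<n. d k * ?L (\<lambda>z. z j * F k z)) = (\<Sum>k<\<rho>. ?L (h k))"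
      by (rule right_minus_eq[THEN iffD1])
    \<comment> \<open>Terms with \<open>d k > 0\<close> vanish by choice of the functional. For
      \<open>k = q\<close> all summands are nonpositive, so keeping only \<open>j0\<close> can only
      increase the sum.\<close>
    have "(\<Sum>k<N. \<Sum>j<n. d k * ?L (\<lambda>z. z j * F k z)) \<le> (\<Sum>k<N. if k = q then d q * ?L (\<lambda>z. z j0 * F q z) else 0)"
    proof (rule sum_mono)
      fix k assume "k \<in> {..<N}"
      then have "d k > 0 \<or> d k = 0 \<or> k = q" using q(3)[of k] by (cases "d k < 0") auto
      then consider (1) "d k > 0" | (2) "d k = 0" | (3) "k = q" by (elim disjE)
      then show "(\<Sum>j<n. d k * ?L (\<lambda>z. z j * F k z)) \<le> (if k = q then d q * ?L (\<lambda>z. z j0 * F q z) else 0)"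
      proof cases
        case 1
        then have "(\<Sum>z\<in>T. a z * (z j * F k z)) = 0" if "j < n" for j
          using van that \<open>k \<in> {..<N}\<close> by auto
        then show ?thesis using 1 q(2) by auto
      next
        case 3
        have "(\<Sum>j<n. - d q * ?L (\<lambda>z. z j * F q z)) \<ge> - d q * ?L (\<lambda>z. z j0 * F q z)"
          by (rule member_le_sum) (use j0 q(2) in \<open>auto intro!: mult_nonpos_nonneg\<close>)
        then show ?thesis using 3 by (simp add: sum_negf)
      qed (use q(2) in auto)
    qed
    also have "\<dots> = d q * ?L (\<lambda>z. z j0 * F q z)" using q(1) by simp
    also have "\<dots> < 0" using nz q(2) by (simp add: mult_neg_pos)
    finally show False unfolding eq using sum_nonneg[of "{..<\<rho>}" "\<lambda>k. ?L (h k)"] by auto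
  qed
  with span_or_separated[of ?I UNIV "\<lambda>z. z j0 * F q z" "\<lambda>i z. z (snd i) * F (fst i) z"]
  obtain b where b: "\<forall>z\<in>UNIV. z j0 * F q z = (\<Sum>i\<in>?I. b i * (z (snd i) * F (fst i) z))"
    by fastforce
  have "z j0 * F q z = (\<Sum>k\<in>?Pos. lform n (\<lambda>j. b (k, j)) z * F k z)" for z
  proof -
    have "z j0 * F q z = (\<Sum>i\<in>?I. b i * (z (snd i) * F (fst i) z))" using b by blast
    also have "\<dots> = (\<Sum>k\<in>?Pos. \<Sum>j<n. b (k, j) * (z j * F k z))"
      unfolding sum.cartesian_product by (intro sum.cong) auto
    finally show ?thesis unfolding lform_def sum_distrib_right by (simp only: mult.assoc)
  qed
  then show ?thesis by (intro exI[of _ "\<lambda>k j. b (k, j)"]) blast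
qed

lemma at_least_n_positive:
  assumes n: "1 \<le> n" "n \<le> 3" and herm: "hermitian_coeffs n m c"
    and sig: "signature n m c = (P, 1)"
    and sn: "squared_norm n (\<lambda>z. bihom n m c z * normsq n z)"
  shows "n \<le> P"
proof (rule ccontr)
  assume "\<not> n \<le> P"
  then have P: "P < n" by simp
  show False
  proof (rule diagonal_form[OF herm])
    fix N :: nat and d :: "nat \<Rightarrow> real" and F
    assume F: "\<And>k. polyfun (F k)"
      and bi: "\<And>z. bihom n m c z = (\<Sum>k<N. complex_of_real (d k) * (F k z * cnj (F k z)))"
      and ind: "\<And>b k. (\<forall>z. (\<Sum>k<N. b k * F k z) = 0) \<Longrightarrow> k < N \<Longrightarrow> b k = 0"
      and card: "signature n m c = (card {k. k < N \<and> d k > 0}, card {k. k < N \<and> d k < 0})"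
    let ?Pos = "{k. k < N \<and> d k > 0}"
    have cP: "card ?Pos = P" and "card {k. k < N \<and> d k < 0} = 1" using card sig by auto
    then obtain q where q: "{k. k < N \<and> d k < 0} = {q}" by (auto simp: card_1_singleton_iff)
    have q': "q < N" "d q < 0" "\<And>k. k < N \<Longrightarrow> d k < 0 \<Longrightarrow> k = q" using q by auto
    \<comment> \<open>Such a relation contradicts independence: its coefficient at \<open>q\<close>
      is -1, and \<open>q\<close> lies outside \<open>?Pos\<close> because
      \<open>d q < 0\<close>.\<close>
    have contra: False if b: "\<And>z. F q z = (\<Sum>k\<in>?Pos. b k * F k z)" for b
    proof -
      define b' where "b' k = (if k = q then - 1 else if k \<in> ?Pos then b k else 0)" for k
      have "(\<Sum>k<N. b' k * F k z) = 0" for z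
      proof -
        have "(\<Sum>k<N. b' k * F k z) = (\<Sum>k<N. (if k = q then - F q z else 0) + (if k \<in> ?Pos then b k * F k z else 0))"
          using q'(2) by (intro sum.cong) (auto simp: b'_def)
        also have "\<dots> = - F q z + (\<Sum>k\<in>{..<N} \<inter> ?Pos. b k * F k z)"
          using q'(1) by (simp only: sum.distrib sum.inter_restrict finite_lessThan) simp
        also have "{..<N} \<inter> ?Pos = ?Pos" by auto
        finally show ?thesis using b[of z] by simp
      qed
      then show False using ind[of b' q] q'(1) by (simp add: b'_def)
    qed
    have "\<exists>a. \<forall>z. z j * F q z = (\<Sum>k\<in>?Pos. lform n (a k) z * F k z)" if "j < n" for j
      by (rule multiplier_span[where F = F and d = d and N = N, OF F sn[unfolded bi] q' that])
    then obtain a where a: "\<And>j z. j < n \<Longrightarrow> z j * F q z = (\<Sum>k\<in>?Pos. lform n (a j k) z * F k z)"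
      by metis
    \<comment> \<open>As \<open>P < n \<le> 3\<close>, two positive terms occur only in three
      variables, the case of the two-term syzygy.\<close>
    consider "P = 0" | "P = 1" | "P = 2" "n = 3" using P n by linarith
    then show False
    proof cases
      case 1
      then have Pos: "?Pos = {}" using cP by auto
      \<comment> \<open>Without positive terms all \<open>z j * F q z\<close> vanish; the one-term
        lemma with the zero function then gives \<open>F q = 0\<close>.\<close>
      have "\<exists>l. \<forall>z. F q z = l * 0"
      proof (rule linear_multiple_imp_proportional[where n = n and f = "\<lambda>_. 0" and A = "\<lambda>_ _. 0"])
        show "z j * F q z = lform n (\<lambda>_. 0) z * 0" if "j < n" for z j
          using a[OF that, of z] unfolding Pos by simp
      qed (use n F polyfun_const in auto)
      then show False using contra[of "\<lambda>_. 0"] by simp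
    next
      case 2
      then obtain k where k: "?Pos = {k}" using cP by (auto simp: card_1_singleton_iff)
      have "\<exists>l. \<forall>z. F q z = l * F k z"
      proof (rule linear_multiple_imp_proportional[where n = n and f = "F k" and A = "\<lambda>j. a j k"])
        show "z j * F q z = lform n (a j k) z * F k z" if "j < n" for z j
          using a[OF that, of z] unfolding k by simp
      qed (use n F in auto)
      then obtain l where "\<forall>z. F q z = l * F k z" by (rule exE)
      then show False using contra[of "\<lambda>_. l"] unfolding k by simp
    next
      case 3
      then obtain k k' where k: "?Pos = {k, k'}" "k \<noteq> k'" using cP by (auto simp: card_2_iff)
      have "z j * F q z = lform 3 (a j k) z * F k z + lform 3 (a j k') z * F k' z" if "j < 3" for z j
        using a[of j z] that 3 unfolding k(1) using k(2) by simp
      then have "\<exists>\<alpha> \<beta>. \<forall>z. F q z = \<alpha> * F k z + \<beta> * F k' z"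
        by (intro linear_syzygy_three[where A = "\<lambda>j. a j k" and B = "\<lambda>j. a j k'"] F)
      then obtain \<alpha> \<beta> where "\<forall>z. F q z = \<alpha> * F k z + \<beta> * F k' z" by (elim exE)
      then show False using contra[of "\<lambda>i. if i = k then \<alpha> else \<beta>"] k(2) unfolding k(1) by simp
    qed
  qed
qed

section \<open>Witnesses in at least four variables\<close>

lemma holo_poly_const: "holo_poly n (\<lambda>z. c)"
  unfolding holo_poly_def
  by (intro exI[of _ "{replicate n 0}"] exI[of _ "\<lambda>_. c"]) (simp add: mono_def)

lemma holo_poly_add:
  assumes "holo_poly n f" "holo_poly n g"
  shows "holo_poly n (\<lambda>z. f z + g z)"
proof -
  obtain S a where S: "finite S" "\<forall>\<alpha>\<in>S. length \<alpha> = n" "\<And>z. f z = (\<Sum>\<alpha>\<in>S. a \<alpha> * mono z \<alpha>)"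
    using assms(1) unfolding holo_poly_def by auto
  obtain T b where T: "finite T" "\<forall>\<alpha>\<in>T. length \<alpha> = n" "\<And>z. g z = (\<Sum>\<alpha>\<in>T. b \<alpha> * mono z \<alpha>)"
    using assms(2) unfolding holo_poly_def by auto
  let ?c = "\<lambda>\<alpha>. (if \<alpha> \<in> S then a \<alpha> else 0) + (if \<alpha> \<in> T then b \<alpha> else 0)"
  have "f z + g z = (\<Sum>\<alpha>\<in>S \<union> T. ?c \<alpha> * mono z \<alpha>)" for z
  proof -
    have "f z = (\<Sum>\<alpha>\<in>S \<union> T. (if \<alpha> \<in> S then a \<alpha> else 0) * mono z \<alpha>)"
      unfolding S(3) using S(1) T(1) by (intro sum.mono_neutral_cong_left) auto
    moreover have "g z = (\<Sum>\<alpha>\<in>S \<union> T. (if \<alpha> \<in> T then b \<alpha> else 0) * mono z \<alpha>)"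
      unfolding T(3) using S(1) T(1) by (intro sum.mono_neutral_cong_left) auto
    ultimately show ?thesis by (simp add: sum.distrib distrib_right)
  qed
  then show ?thesis unfolding holo_poly_def
    using S(1,2) T(1,2) by (intro exI[of _ "S \<union> T"] exI[of _ ?c]) auto
qed

lemma holo_poly_sum:
  assumes "\<And>i. i \<in> I \<Longrightarrow> holo_poly n (f i)"
  shows "holo_poly n (\<lambda>z. \<Sum>i\<in>I. f i z)"
  using assms by (induction I rule: infinite_finite_induct) (simp_all add: holo_poly_const holo_poly_add)

lemma holo_poly_monomial:
  assumes "length \<alpha> = n"
  shows "holo_poly n (\<lambda>z. c * mono z \<alpha>)"
  unfolding holo_poly_def using assms by (intro exI[of _ "{\<alpha>}"] exI[of _ "\<lambda>_. c"]) simp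

lemma mono_mult:
  assumes "length \<alpha> = n" "length \<beta> = n"
  shows "mono z \<alpha> * mono z \<beta> = mono z (map2 (+) \<alpha> \<beta>)"
  using assms by (simp add: mono_def power_add prod.distrib)

lemma holo_poly_mult:
  assumes "holo_poly n f" "holo_poly n g"
  shows "holo_poly n (\<lambda>z. f z * g z)"
proof -
  obtain S a where S: "\<forall>\<alpha>\<in>S. length \<alpha> = n" "\<And>z. f z = (\<Sum>\<alpha>\<in>S. a \<alpha> * mono z \<alpha>)"
    using assms(1) unfolding holo_poly_def by auto
  obtain T b where T: "\<forall>\<alpha>\<in>T. length \<alpha> = n" "\<And>z. g z = (\<Sum>\<alpha>\<in>T. b \<alpha> * mono z \<alpha>)"
    using assms(2) unfolding holo_poly_def by auto
  have "f z * g z = (\<Sum>\<alpha>\<in>S. \<Sum>\<beta>\<in>T. (a \<alpha> * b \<beta>) * mono z (map2 (+) \<alpha> \<beta>))" for z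
    unfolding S(2) T(2) sum_product
  proof (intro sum.cong refl)
    fix \<alpha> \<beta> assume "\<alpha> \<in> S" "\<beta> \<in> T"
    then have "mono z (map2 (+) \<alpha> \<beta>) = mono z \<alpha> * mono z \<beta>"
      using S(1) T(1) by (simp add: mono_mult)
    then show "a \<alpha> * mono z \<alpha> * (b \<beta> * mono z \<beta>) = (a \<alpha> * b \<beta>) * mono z (map2 (+) \<alpha> \<beta>)"
      by simp
  qed
  moreover have "holo_poly n (\<lambda>z. \<Sum>\<alpha>\<in>S. \<Sum>\<beta>\<in>T. (a \<alpha> * b \<beta>) * mono z (map2 (+) \<alpha> \<beta>))"
    by (intro holo_poly_sum holo_poly_monomial) (use S(1) T(1) in auto)
  ultimately show ?thesis by simp
qed

lemma holo_poly_diff: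
  assumes "holo_poly n f" "holo_poly n g"
  shows "holo_poly n (\<lambda>z. f z - g z)"
  using holo_poly_add[OF assms(1) holo_poly_mult[OF holo_poly_const[of n "-1"] assms(2)]] by simp

lemma holo_poly_coord:
  assumes "i < n"
  shows "holo_poly n (\<lambda>z. z i)"
proof -
  have "mono z ((replicate n 0)[i := 1]) = z i" for z
  proof -
    have "mono z ((replicate n 0)[i := 1]) = (\<Prod>j<n. if j = i then z j else 1)"
      unfolding mono_def by (rule prod.cong) (use assms in \<open>auto simp: nth_list_update\<close>)
    then show ?thesis using assms by simp
  qed
  then show ?thesis using holo_poly_monomial[of "(replicate n 0)[i := 1]" n 1] by simp
qed

lemma squared_norm_cmod:
  assumes "holo_poly n h"
  shows "squared_norm n (\<lambda>z. complex_of_real ((cmod (h z))\<^sup>2))"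
  unfolding squared_norm_def using assms by (intro exI[of _ "1::nat"] exI[of _ "\<lambda>_. h"]) simp

lemma squared_norm_add:
  assumes "squared_norm n s" "squared_norm n t"
  shows "squared_norm n (\<lambda>z. s z + t z)"
proof -
  obtain k :: nat and h where h: "\<forall>i<k. holo_poly n (h i)" "\<forall>z. s z = complex_of_real (\<Sum>i<k. (cmod (h i z))\<^sup>2)"
    using assms(1) unfolding squared_norm_def by blast
  obtain l :: nat and g where g: "\<forall>i<l. holo_poly n (g i)" "\<forall>z. t z = complex_of_real (\<Sum>i<l. (cmod (g i z))\<^sup>2)"
    using assms(2) unfolding squared_norm_def by blast
  have split: "(\<Sum>i<k + l. f i) = (\<Sum>i<k. f i) + (\<Sum>i<l. f (k + i))" for f :: "nat \<Rightarrow> real"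
    by (induction l) (simp_all add: add.assoc)
  show ?thesis unfolding squared_norm_def
  proof (intro exI[of _ "k + l"] exI[of _ "\<lambda>i. if i < k then h i else g (i - k)"] conjI allI impI)
    fix i assume "i < k + l"
    then show "holo_poly n (if i < k then h i else g (i - k))" using h(1) g(1) by auto
  qed (simp add: h(2) g(2) split)
qed

lemma squared_norm_0: "squared_norm n (\<lambda>z. 0)"
  unfolding squared_norm_def by (intro exI[of _ "0::nat"]) simp

lemma squared_norm_sum:
  assumes "\<And>i. i \<in> I \<Longrightarrow> squared_norm n (s i)"
  shows "squared_norm n (\<lambda>z. \<Sum>i\<in>I. s i z)"
  using assms by (induction I rule: infinite_finite_induct) (simp_all add: squared_norm_0 squared_norm_add)

lemma squared_norm_mult:
  assumes "squared_norm n s" "squared_norm n t"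
  shows "squared_norm n (\<lambda>z. s z * t z)"
proof -
  obtain k :: nat and h where h: "\<forall>i<k. holo_poly n (h i)" "\<forall>z. s z = complex_of_real (\<Sum>i<k. (cmod (h i z))\<^sup>2)"
    using assms(1) unfolding squared_norm_def by blast
  obtain l :: nat and g where g: "\<forall>i<l. holo_poly n (g i)" "\<forall>z. t z = complex_of_real (\<Sum>i<l. (cmod (g i z))\<^sup>2)"
    using assms(2) unfolding squared_norm_def by blast
  have "s z * t z = (\<Sum>i<k. \<Sum>j<l. complex_of_real ((cmod (h i z * g j z))\<^sup>2))" for z
    by (simp add: h(2) g(2) sum_product norm_mult power_mult_distrib)
  moreover have "squared_norm n (\<lambda>z. \<Sum>i<k. \<Sum>j<l. complex_of_real ((cmod (h i z * g j z))\<^sup>2))"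
    by (intro squared_norm_sum squared_norm_cmod holo_poly_mult) (use h(1) g(1) in auto)
  ultimately show ?thesis by simp
qed

lemma squared_norm_const:
  assumes "0 \<le> r"
  shows "squared_norm n (\<lambda>z. complex_of_real r)"
  using squared_norm_cmod[OF holo_poly_const, of n "complex_of_real (sqrt r)"] assms by simp

section \<open>Exponents of quadratic monomials\<close>

definition quad_index :: "nat \<Rightarrow> nat \<Rightarrow> nat \<Rightarrow> nat list" where
  "quad_index n i j = map (\<lambda>k. of_bool (k = i) + of_bool (k = j)) [0..<n]"

lemma length_quad_index [simp]: "length (quad_index n i j) = n"
  by (simp add: quad_index_def)

lemma quad_index_in_mis:
  assumes "i < n" "j < n"
  shows "quad_index n i j \<in> set (mis n 2)"
proof -
  have "sum_list (quad_index n i j) = (\<Sum>k<n. of_bool (k = i) + of_bool (k = j))"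
    by (simp add: quad_index_def interv_sum_list_conv_sum_set_nat lessThan_atLeast0)
  also have "\<dots> = 2" using assms by (simp add: sum.distrib of_bool_def)
  finally show ?thesis by (simp add: set_mis)
qed

lemma mono_quad_index:
  assumes "i < n" "j < n"
  shows "mono z (quad_index n i j) = z i * z j"
proof -
  have *: "(\<Prod>k<n. z k ^ of_bool (k = l)) = z l" if "l < n" for l
  proof -
    have "(\<Prod>k<n. z k ^ of_bool (k = l)) = (\<Prod>k<n. if k = l then z k else 1)"
      by (intro prod.cong) auto
    then show ?thesis using that by simp
  qed
  have "mono z (quad_index n i j) = (\<Prod>k<n. z k ^ of_bool (k = i) * z k ^ of_bool (k = j))"
    by (simp add: mono_def quad_index_def power_add)
  then show ?thesis using assms by (simp add: prod.distrib *)
qed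

lemma quad_index_inj:
  assumes "i < j" "j < n" "k < l" "l < n" and eq: "quad_index n i j = quad_index n k l"
  shows "i = k \<and> j = l"
proof -
  have nth: "quad_index n x y ! m = of_bool (m = x) + of_bool (m = y)" if "m < n" for x y m
    using that by (simp add: quad_index_def)
  have "i = k \<or> i = l"
    using arg_cong[OF eq, of "\<lambda>xs. xs ! i"] assms(1,2) by (cases "i = k"; cases "i = l") (simp_all add: nth)
  moreover have "j = k \<or> j = l"
    using arg_cong[OF eq, of "\<lambda>xs. xs ! j"] assms(1,2) by (cases "j = k"; cases "j = l") (simp_all add: nth)
  ultimately show ?thesis using assms(1,3) by auto
qed

text \<open>Only the values of \<open>\<beta>\<close> on \<open>{a, b}\<close> and of \<open>g\<close> off \<open>{a, b}\<close> matter.\<close>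
definition block2 :: "nat \<Rightarrow> nat \<Rightarrow> nat \<Rightarrow> (nat \<Rightarrow> nat \<Rightarrow> complex) \<Rightarrow> (nat \<Rightarrow> complex) \<Rightarrow> complex mat" where
  "block2 N a b \<beta> g = mat N N (\<lambda>(i, j). if i \<in> {a, b} \<and> j \<in> {a, b} then \<beta> i j else if i = j then g i else 0)"

lemma block2_carrier [simp, intro]: "block2 N a b \<beta> g \<in> carrier_mat N N"
  by (simp add: block2_def)

text \<open>Up to the order of the basis these are a 2 by 2 block beside a diagonal: the sum over
  \<open>k\<close> reduces to \<open>{a, b}\<close> for rows in the block and to
  \<open>k = i\<close> elsewhere.\<close>

lemma block2_mult:
  assumes "a < N" "b < N" "a \<noteq> b"
  shows "block2 N a b \<beta> g * block2 N a b \<beta>' g'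
    = block2 N a b (\<lambda>i j. \<beta> i a * \<beta>' a j + \<beta> i b * \<beta>' b j) (\<lambda>i. g i * g' i)"
proof (rule eq_matI)
  fix i j assume "i < dim_row (block2 N a b (\<lambda>i j. \<beta> i a * \<beta>' a j + \<beta> i b * \<beta>' b j) (\<lambda>i. g i * g' i))"
    "j < dim_col (block2 N a b (\<lambda>i j. \<beta> i a * \<beta>' a j + \<beta> i b * \<beta>' b j) (\<lambda>i. g i * g' i))"
  then have ij: "i < N" "j < N" by (auto simp: block2_def)
  let ?A = "block2 N a b \<beta> g" and ?B = "block2 N a b \<beta>' g'"
  let ?C = "block2 N a b (\<lambda>i j. \<beta> i a * \<beta>' a j + \<beta> i b * \<beta>' b j) (\<lambda>i. g i * g' i)"
  have "(?A * ?B) $$ (i, j) = (\<Sum>k<N. ?A $$ (i, k) * ?B $$ (k, j))"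
    by (rule mult_mat_entry[OF block2_carrier block2_carrier ij])
  also have "\<dots> = ?C $$ (i, j)"
  proof (cases "i \<in> {a, b}")
    case True
    have "(\<Sum>k<N. ?A $$ (i, k) * ?B $$ (k, j)) = (\<Sum>k\<in>{a, b}. ?A $$ (i, k) * ?B $$ (k, j))"
      using assms ij True by (intro sum.mono_neutral_right) (auto simp: block2_def)
    also have "\<dots> = ?C $$ (i, j)" using assms ij True by (auto simp: block2_def)
    finally show ?thesis .
  next
    case False
    have "(\<Sum>k<N. ?A $$ (i, k) * ?B $$ (k, j)) = (\<Sum>k\<in>{i}. ?A $$ (i, k) * ?B $$ (k, j))"
      using assms ij False by (intro sum.mono_neutral_right) (auto simp: block2_def)
    also have "\<dots> = ?C $$ (i, j)" using assms ij False by (auto simp: block2_def)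
    finally show ?thesis .
  qed
  finally show "(?A * ?B) $$ (i, j) = ?C $$ (i, j)" .
qed (auto simp: block2_def)

text \<open>The block with diagonal \<open>x\<close> and off-diagonal \<open>y\<close> has
  eigenvectors (1, 1) and (1, -1) for \<open>x + y\<close> and \<open>x - y\<close>. Divided by sqrt
  2 they form the block columns of the self-adjoint \<open>U\<close>.\<close>

lemma num_eig_block2:
  fixes x y :: real and w :: "nat \<Rightarrow> real"
  assumes "a < N" "b < N" "a \<noteq> b"
    and A: "A = block2 N a b (\<lambda>i j. if i = j then complex_of_real x else complex_of_real y) (\<lambda>i. complex_of_real (w i))"
  defines "d \<equiv> \<lambda>i. if i = a then x + y else if i = b then x - y else w i"
  shows "num_pos_eig A = card {i. i < N \<and> d i > 0}" "num_neg_eig A = card {i. i < N \<and> d i < 0}"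
proof -
  define s where "s = complex_of_real (1 / sqrt 2)"
  have "(1 / sqrt 2) * (1 / sqrt 2) = (1 / 2 :: real)" by simp
  then have ss: "s * s = 1 / 2" unfolding s_def of_real_mult[symmetric] by simp
  have cs: "cnj s = s" by (simp add: s_def)
  define U where "U = block2 N a b (\<lambda>i j. if i = b \<and> j = b then - s else s) (\<lambda>_. 1)"
  have U: "U \<in> carrier_mat N N" by (simp add: U_def)
  have aU: "adj U = U" by (rule eq_matI) (auto simp: U_def adj_def block2_def cs)
  have UU: "adj U * U = 1\<^sub>m N"
    unfolding aU unfolding U_def block2_mult[OF assms(1-3)]
    by (rule eq_matI) (use assms(3) in \<open>auto simp: block2_def ss\<close>)
  have s2: "s * (s * t) = t / 2" "s * (t * s) = t / 2" for t
    using ss by (simp_all add: mult.assoc[symmetric] mult.commute[of t])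
  have "adj U * A * U = diag_of N d"
    unfolding aU unfolding U_def A block2_mult[OF assms(1-3)]
    by (rule eq_matI)
      (use assms(3) in \<open>auto simp: block2_def diag_of_def d_def algebra_simps ss s2\<close>)
  from num_eig[OF unitary_similar(2)[OF _ U UU this]]
  show "num_pos_eig A = card {i. i < N \<and> d i > 0}" "num_neg_eig A = card {i. i < N \<and> d i < 0}"
    by (simp_all add: A)
qed

lemma card_nth_Collect:
  assumes "distinct xs"
  shows "card {i. i < length xs \<and> Q (xs ! i)} = card {x \<in> set xs. Q x}"
proof -
  have "{x \<in> set xs. Q x} = (!) xs ` {i. i < length xs \<and> Q (xs ! i)}"
    by (auto simp: in_set_conv_nth)
  then show ?thesis
    using assms by (simp add: card_image inj_on_def nth_eq_iff_index_eq)
qed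

section \<open>The witness polynomial\<close>

text \<open>Counting variables from zero, these are the exponents of \<open>z 0 * z 3\<close>,
  \<open>z 1 * z 2\<close> and \<open>z 2 * z j\<close> with \<open>j \<ge> 4\<close>, the monomial
  quadrics of the overview.\<close>

definition cross_index :: "nat \<Rightarrow> nat list set" where
  "cross_index n = (\<lambda>(i, j). quad_index n i j) ` ({(0, 3), (1, 2)} \<union> Pair 2 ` {4..<n})"

text \<open>Coefficients of \<open>2 |z\<^sub>0 z\<^sub>1 - z\<^sub>2 z\<^sub>3|\<^sup>2 - |z\<^sub>0 z\<^sub>1 + z\<^sub>2 z\<^sub>3|\<^sup>2 + 8 (|z\<^sub>0 z\<^sub>3|\<^sup>2 + |z\<^sub>1 z\<^sub>2|\<^sup>2 + \<Sum>\<^sub>j |z\<^sub>2 z\<^sub>j|\<^sup>2)\<close>, where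
  \<open>j \<ge> 4\<close>; the two quadrics in the first terms are orthogonal, which makes the spectrum explicit.\<close>
definition witness_coeff :: "nat \<Rightarrow> nat list \<Rightarrow> nat list \<Rightarrow> complex" where
  "witness_coeff n \<alpha> \<beta> =
    (if \<alpha> = \<beta> then if \<alpha> \<in> {quad_index n 0 1, quad_index n 2 3} then 1 else if \<alpha> \<in> cross_index n then 8 else 0
     else if \<alpha> \<in> {quad_index n 0 1, quad_index n 2 3} \<and> \<beta> \<in> {quad_index n 0 1, quad_index n 2 3} then - 3 else 0)"

context
  fixes n :: nat
  assumes n: "4 \<le> n"
begin

lemma inj_cross: "inj_on (\<lambda>(i, j). quad_index n i j) ({(0, 3), (1, 2)} \<union> Pair 2 ` {4..<n})"
  using n by (auto simp: inj_on_def dest!: quad_index_inj[rotated 4])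

lemma cross_index_facts:
  "quad_index n 0 1 \<noteq> quad_index n 2 3" "quad_index n 0 1 \<notin> cross_index n" "quad_index n 2 3 \<notin> cross_index n"
  "finite (cross_index n)" "card (cross_index n) = n - 2" "cross_index n \<subseteq> set (mis n 2)"
proof -
  show "quad_index n 0 1 \<noteq> quad_index n 2 3" "quad_index n 0 1 \<notin> cross_index n" "quad_index n 2 3 \<notin> cross_index n"
    using n by (auto simp: cross_index_def dest!: quad_index_inj[rotated 4])
  show "finite (cross_index n)" by (simp add: cross_index_def)
  have "card ({(0, 3), (1, 2)} \<union> Pair 2 ` {4..<n} :: (nat \<times> nat) set) = n - 2"
    using n by (subst card_Un_disjoint) (auto simp: card_image inj_on_def)
  then show "card (cross_index n) = n - 2" unfolding cross_index_def card_image[OF inj_cross] .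
  show "cross_index n \<subseteq> set (mis n 2)"
    using n by (auto simp: cross_index_def intro!: quad_index_in_mis)
qed

lemma witness_hermitian: "hermitian_coeffs n 2 (witness_coeff n)"
  unfolding hermitian_coeffs_def witness_coeff_def by auto

text \<open>The matrix is a block with diagonal 1 and off-diagonal -3, hence eigenvalues -2 and 4,
  beside \<open>n - 2\<close> diagonal entries 8 and zeros.\<close>

lemma witness_signature: "signature n 2 (witness_coeff n) = (n - 1, 1)"
proof -
  let ?L = "mis n 2"
  define p where "p = quad_index n 0 1"
  define q where "q = quad_index n 2 3"
  note facts = cross_index_facts[folded p_def q_def]
  note coeff = witness_coeff_def[of n, folded p_def q_def]
  have pq: "p \<in> set ?L" "q \<in> set ?L" unfolding p_def q_def using n by (auto intro!: quad_index_in_mis)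
  then obtain a b where a: "a < length ?L" "?L ! a = p" and b: "b < length ?L" "?L ! b = q"
    by (auto simp: in_set_conv_nth)
  have ab: "a \<noteq> b" using a b facts(1) by auto
  have ia: "?L ! i = p \<longleftrightarrow> i = a" if "i < length ?L" for i
    using nth_eq_iff_index_eq[OF distinct_mis that a(1)] a(2) by simp
  have ib: "?L ! i = q \<longleftrightarrow> i = b" if "i < length ?L" for i
    using nth_eq_iff_index_eq[OF distinct_mis that b(1)] b(2) by simp
  define w where "w \<alpha> = (if \<alpha> \<in> cross_index n then 8 else 0 :: real)" for \<alpha>
  define D where "D \<alpha> = (if \<alpha> = p then 1 + - 3 else if \<alpha> = q then 1 - - 3 else w \<alpha>)" for \<alpha>
  have "coeff_mat n 2 (witness_coeff n) = block2 (length ?L) a b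
      (\<lambda>i j. if i = j then complex_of_real 1 else complex_of_real (- 3)) (\<lambda>i. complex_of_real (w (?L ! i)))"
    unfolding coeff_mat_def block2_def
    by (rule eq_matI) (auto simp: coeff ia ib w_def nth_eq_iff_index_eq[OF distinct_mis])
  note eig = num_eig_block2[OF a(1) b(1) ab this]
  have idx: "(if i = a then 1 + - 3 else if i = b then 1 - - 3 else w (?L ! i)) = D (?L ! i)" if "i < length ?L" for i
    using that ia ib by (simp add: D_def)
  have "num_pos_eig (coeff_mat n 2 (witness_coeff n)) = card {\<alpha> \<in> set ?L. D \<alpha> > 0}"
    unfolding eig(1) card_nth_Collect[OF distinct_mis, symmetric] by (intro arg_cong[of _ _ card] Collect_cong conj_cong refl) (simp only: idx)
  also have "{\<alpha> \<in> set ?L. D \<alpha> > 0} = insert q (cross_index n)"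
    using pq facts(1-3,6) by (auto simp: D_def w_def split: if_splits)
  also have "card \<dots> = n - 1" using facts(3-5) n by simp
  finally have 1: "num_pos_eig (coeff_mat n 2 (witness_coeff n)) = n - 1" .
  have "num_neg_eig (coeff_mat n 2 (witness_coeff n)) = card {\<alpha> \<in> set ?L. D \<alpha> < 0}"
    unfolding eig(2) card_nth_Collect[OF distinct_mis, symmetric] by (intro arg_cong[of _ _ card] Collect_cong conj_cong refl) (simp only: idx)
  also have "{\<alpha> \<in> set ?L. D \<alpha> < 0} = {p}"
    using pq by (auto simp: D_def w_def split: if_splits)
  finally show ?thesis using 1 by (simp add: signature_def)
qed

text \<open>For \<open>u = z 0 * z 1\<close> and \<open>v = z 2 * z 3\<close> the block contributes
  |u|^2 + |v|^2 - 6 Re (u cnj v), which equals 2 |u - v|^2 - |u + v|^2; the exponents in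
  \<open>cross_index\<close> give diagonal terms only.\<close>

lemma bihom_witness:
  "bihom n 2 (witness_coeff n) z = complex_of_real (2 * (cmod (z 0 * z 1 - z 2 * z 3))\<^sup>2 - (cmod (z 0 * z 1 + z 2 * z 3))\<^sup>2
    + 8 * ((cmod (z 0))\<^sup>2 * (cmod (z 3))\<^sup>2 + (cmod (z 1))\<^sup>2 * (cmod (z 2))\<^sup>2 + (cmod (z 2))\<^sup>2 * (\<Sum>j=4..<n. (cmod (z j))\<^sup>2)))"
proof -
  let ?L = "set (mis n 2)"
  define p where "p = quad_index n 0 1"
  define q where "q = quad_index n 2 3"
  note facts = cross_index_facts[folded p_def q_def]
  note coeff = witness_coeff_def[of n, folded p_def q_def]
  let ?m = "mono z" and ?C = "cross_index n"
  have pq: "p \<in> ?L" "q \<in> ?L" unfolding p_def q_def using n by (auto intro!: quad_index_in_mis)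
  have mp: "?m p = z 0 * z 1" "?m q = z 2 * z 3" unfolding p_def q_def using n by (simp_all add: mono_quad_index)
  define f where "f \<alpha> \<beta> = witness_coeff n \<alpha> \<beta> * ?m \<alpha> * cnj (?m \<beta>)" for \<alpha> \<beta>
  have "(\<Sum>\<beta>\<in>?L. f \<alpha> \<beta>) = (if \<alpha> = p then f p p + f p q else 0)
      + (if \<alpha> = q then f q p + f q q else 0) + (if \<alpha> \<in> ?C then f \<alpha> \<alpha> else 0)" if "\<alpha> \<in> ?L" for \<alpha>
  proof (cases "\<alpha> \<in> {p, q}")
    case True
    have "(\<Sum>\<beta>\<in>?L. f \<alpha> \<beta>) = (\<Sum>\<beta>\<in>{p, q}. f \<alpha> \<beta>)"
      using True pq by (intro sum.mono_neutral_right) (auto simp: f_def coeff)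
    then show ?thesis using True facts(1-3) by auto
  next
    case False
    have "(\<Sum>\<beta>\<in>?L. f \<alpha> \<beta>) = (\<Sum>\<beta>\<in>{\<alpha>}. f \<alpha> \<beta>)"
      using False that by (intro sum.mono_neutral_right) (auto simp: f_def coeff)
    then show ?thesis using False by (auto simp: f_def coeff)
  qed
  then have "bihom n 2 (witness_coeff n) z = (\<Sum>\<alpha>\<in>?L. (if \<alpha> = p then f p p + f p q else 0)
      + (if \<alpha> = q then f q p + f q q else 0) + (if \<alpha> \<in> ?C then f \<alpha> \<alpha> else 0))"
    unfolding bihom_def f_def[symmetric] by (intro sum.cong refl)
  also have "\<dots> = (f p p + f p q) + (f q p + f q q) + (\<Sum>\<alpha>\<in>?C. f \<alpha> \<alpha>)"
    using pq facts(6) by (simp add: sum.distrib sum.inter_restrict[symmetric] Int_absorb1)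
  also have "(\<Sum>\<alpha>\<in>?C. f \<alpha> \<alpha>) = (\<Sum>\<alpha>\<in>?C. complex_of_real (8 * (cmod (?m \<alpha>))\<^sup>2))"
    using facts(2,3)
    by (intro sum.cong refl) (auto simp: f_def coeff complex_norm_square simp del: of_real_power)
  also have "\<dots> = complex_of_real (8 * ((cmod (z 0))\<^sup>2 * (cmod (z 3))\<^sup>2 + (cmod (z 1))\<^sup>2 * (cmod (z 2))\<^sup>2
      + (cmod (z 2))\<^sup>2 * (\<Sum>j=4..<n. (cmod (z j))\<^sup>2)))"
  proof -
    let ?g = "\<lambda>(i, j). 8 * (cmod (?m (quad_index n i j)))\<^sup>2"
    have "(\<Sum>\<alpha>\<in>?C. 8 * (cmod (?m \<alpha>))\<^sup>2) = (\<Sum>x\<in>{(0, 3), (1, 2)} \<union> Pair 2 ` {4..<n}. ?g x)"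
      unfolding cross_index_def by (subst sum.reindex[OF inj_cross]) (simp add: comp_def case_prod_unfold)
    also have "\<dots> = (\<Sum>x\<in>{(0, 3), (1, 2)}. ?g x) + (\<Sum>x\<in>Pair 2 ` {4..<n}. ?g x)"
      by (rule sum.union_disjoint) auto
    also have "(\<Sum>x\<in>Pair 2 ` {4..<n}. ?g x) = (\<Sum>j=4..<n. ?g (2, j))"
      by (subst sum.reindex) (auto simp: inj_on_def)
    also have "\<dots> = (\<Sum>j=4..<n. 8 * (cmod (z 2))\<^sup>2 * (cmod (z j))\<^sup>2)"
      using n by (intro sum.cong) (auto simp: mono_quad_index norm_mult power_mult_distrib)
    finally have "(\<Sum>\<alpha>\<in>?C. 8 * (cmod (?m \<alpha>))\<^sup>2) = 8 * ((cmod (z 0))\<^sup>2 * (cmod (z 3))\<^sup>2 + (cmod (z 1))\<^sup>2 * (cmod (z 2))\<^sup>2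
      + (cmod (z 2))\<^sup>2 * (\<Sum>j=4..<n. (cmod (z j))\<^sup>2))"
      using n by (simp add: mono_quad_index norm_mult power_mult_distrib sum_distrib_left distrib_left mult.assoc)
    then show ?thesis by (simp only: of_real_sum[symmetric])
  qed
  also have "(f p p + f p q) + (f q p + f q q)
      = complex_of_real (2 * (cmod (z 0 * z 1 - z 2 * z 3))\<^sup>2 - (cmod (z 0 * z 1 + z 2 * z 3))\<^sup>2)"
  proof -
    have "(f p p + f p q) + (f q p + f q q) = ?m p * cnj (?m p) + ?m q * cnj (?m q)
        - 3 * ?m p * cnj (?m q) - 3 * ?m q * cnj (?m p)"
      using facts(1) by (simp add: f_def coeff)
    then show ?thesis unfolding mp
      by (simp add: complex_norm_square algebra_simps del: of_real_power)
  qed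
  finally show ?thesis by simp
qed

text \<open>The parallelogram law absorbs the negative term, once with \<open>2 z\<^sub>2 z\<^sub>3\<close> and once with \<open>2 z\<^sub>0 z\<^sub>1\<close> as increment.\<close>
lemma witness_squared_norm: "squared_norm n (\<lambda>z. bihom n 2 (witness_coeff n) z * normsq n z)"
proof -
  define a where "a i z = (cmod (z i))\<^sup>2" for i :: nat and z :: "nat \<Rightarrow> complex"
  define R where "R z = (\<Sum>j=4..<n. a j z)" for z
  define F where "F z = z 0 * z 1 - z 2 * z 3" for z :: "nat \<Rightarrow> complex"
  define H where "H z = (cmod (F z - 2 * (z 2 * z 3)))\<^sup>2" for z
  define H' where "H' z = (cmod (F z + 2 * (z 0 * z 1)))\<^sup>2" for z
  let ?r = complex_of_real
  have par: "2 * (cmod u)\<^sup>2 - (cmod (u + v))\<^sup>2 = (cmod (u - v))\<^sup>2 - 2 * (cmod v)\<^sup>2" for u v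
    unfolding cmod_power2 by (simp add: power2_eq_square algebra_simps)
  \<comment> \<open>\<open>H\<close> serves the part \<open>a 0 + a 1 + R\<close> of the norm and
    \<open>H'\<close> the part \<open>a 2 + a 3\<close>. This leaves -8 times
    \<open>a 2 * a 3 * (a 0 + a 1 + R)\<close> and \<open>a 0 * a 1 * (a 2 + a 3)\<close>, which
    parts of the weight-8 terms cancel exactly; what remains has nonnegative coefficients.\<close>
  have eq: "bihom n 2 (witness_coeff n) z * normsq n z
    = (?r (a 0 z) + ?r (a 1 z) + ?r (R z)) * ?r (H z) + (?r (a 2 z) + ?r (a 3 z)) * ?r (H' z)
      + ?r 8 * (?r (a 0 z) * ?r (a 3 z) * (?r (a 0 z) + ?r (a 3 z) + ?r (R z))
        + ?r (a 1 z) * ?r (a 2 z) * (?r (a 1 z) + ?r (a 2 z) + ?r (R z))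
        + ?r (a 2 z) * ?r (R z) * (?r (a 0 z) + ?r (a 1 z) + ?r (a 2 z) + ?r (R z)))" for z
  proof -
    let ?D = "2 * (cmod (z 0 * z 1 - z 2 * z 3))\<^sup>2 - (cmod (z 0 * z 1 + z 2 * z 3))\<^sup>2"
    have D1: "?D = H z - 8 * a 2 z * a 3 z"
    proof -
      have 1: "F z + 2 * (z 2 * z 3) = z 0 * z 1 + z 2 * z 3" by (simp add: F_def)
      have 2: "2 * (cmod (2 * (z 2 * z 3)))\<^sup>2 = 8 * a 2 z * a 3 z"
        by (simp add: a_def norm_mult power_mult_distrib mult.assoc)
      show ?thesis using par[of "F z" "2 * (z 2 * z 3)"] unfolding 1 2 H_def by (simp only: F_def)
    qed
    have D2: "?D = H' z - 8 * a 0 z * a 1 z"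
    proof -
      \<comment> \<open>The increment \<open>- (2 * (z 0 * z 1))\<close> turns \<open>F\<close> into
        minus the sum of the two products, and the modulus ignores the sign.\<close>
      have "F z + - (2 * (z 0 * z 1)) = - (z 0 * z 1 + z 2 * z 3)" by (simp add: F_def)
      then have 1: "cmod (F z + - (2 * (z 0 * z 1))) = cmod (z 0 * z 1 + z 2 * z 3)"
        by (simp only: norm_minus_cancel)
      have 2: "2 * (cmod (- (2 * (z 0 * z 1))))\<^sup>2 = 8 * a 0 z * a 1 z"
        by (simp add: a_def norm_mult power_mult_distrib mult.assoc)
      show ?thesis using par[of "F z" "- (2 * (z 0 * z 1))"]
        unfolding 1 2 H'_def diff_minus_eq_add by (simp only: F_def)
    qed
    have N: "normsq n z = ?r (a 0 z + a 1 z + a 2 z + a 3 z + R z)"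
    proof -
      have split: "{..<n} = {0, 1, 2, 3} \<union> {4..<n}" using n by auto
      have "(\<Sum>j<n. a j z) = (\<Sum>j\<in>{0, 1, 2, 3}. a j z) + R z"
        unfolding split R_def by (rule sum.union_disjoint) auto
      also have "(\<Sum>j\<in>{0, 1, 2, 3}. a j z) = a 0 z + a 1 z + a 2 z + a 3 z" by simp
      finally have "normsq n z = complex_of_real (a 0 z + a 1 z + a 2 z + a 3 z + R z)"
        unfolding normsq_def a_def by (simp only:)
      then show ?thesis .
    qed
    have real: "(?D + 8 * (a 0 z * a 3 z + a 1 z * a 2 z + a 2 z * R z)) * (a 0 z + a 1 z + a 2 z + a 3 z + R z)
      = (a 0 z + a 1 z + R z) * H z + (a 2 z + a 3 z) * H' z
      + 8 * (a 0 z * a 3 z * (a 0 z + a 3 z + R z) + a 1 z * a 2 z * (a 1 z + a 2 z + R z)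
        + a 2 z * R z * (a 0 z + a 1 z + a 2 z + R z))"
    proof -
      have "?D * (a 0 z + a 1 z + a 2 z + a 3 z + R z)
          = ?D * (a 0 z + a 1 z + R z) + ?D * (a 2 z + a 3 z)" by (simp add: algebra_simps)
      also have "\<dots> = (H z - 8 * a 2 z * a 3 z) * (a 0 z + a 1 z + R z) + (H' z - 8 * a 0 z * a 1 z) * (a 2 z + a 3 z)"
        using D1 D2 by simp
      finally show ?thesis by (simp add: algebra_simps)
    qed
    have "bihom n 2 (witness_coeff n) z * normsq n z
      = ?r ((?D + 8 * (a 0 z * a 3 z + a 1 z * a 2 z + a 2 z * R z)) * (a 0 z + a 1 z + a 2 z + a 3 z + R z))"
      unfolding bihom_witness N by (simp only: of_real_mult a_def R_def)
    then show ?thesis unfolding real by simp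
  qed
  have sa: "squared_norm n (\<lambda>z. ?r (a i z))" if "i < n" for i
    unfolding a_def by (rule squared_norm_cmod[OF holo_poly_coord[OF that]])
  have sR: "squared_norm n (\<lambda>z. ?r (R z))"
    unfolding R_def of_real_sum by (rule squared_norm_sum) (simp add: sa)
  have hF: "holo_poly n F"
    unfolding F_def using n by (intro holo_poly_diff holo_poly_mult holo_poly_coord) auto
  have sH: "squared_norm n (\<lambda>z. ?r (H z))"
    unfolding H_def using n
    by (intro squared_norm_cmod holo_poly_diff hF holo_poly_mult holo_poly_const holo_poly_coord) auto
  have sH': "squared_norm n (\<lambda>z. ?r (H' z))"
    unfolding H'_def using n
    by (intro squared_norm_cmod holo_poly_add hF holo_poly_mult holo_poly_const holo_poly_coord) auto
  show ?thesis
    unfolding eq using n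
    by (intro squared_norm_add squared_norm_mult sH sH' sR sa squared_norm_const) auto
qed

end

theorem theorem1:
  shows "(\<forall>n m c P. 1 \<le> n \<longrightarrow> n \<le> 3 \<longrightarrow> hermitian_coeffs n m c \<longrightarrow>
            signature n m c = (P, 1) \<longrightarrow>
            squared_norm n (\<lambda>z. bihom n m c z * normsq n z) \<longrightarrow> n \<le> P)
       \<and> (\<forall>n. 4 \<le> n \<longrightarrow> (\<exists>m c P. hermitian_coeffs n m c \<and> signature n m c = (P, 1) \<and>
            squared_norm n (\<lambda>z. bihom n m c z * normsq n z) \<and> P < n))"
proof (intro conjI allI impI)
  fix n m c P
  assume "1 \<le> n" "n \<le> 3" "hermitian_coeffs n m c" "signature n m c = (P, 1)"
    "squared_norm n (\<lambda>z. bihom n m c z * normsq n z)"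
  then show "n \<le> P" by (rule at_least_n_positive)
next
  fix n :: nat
  assume "4 \<le> n"
  then show "\<exists>m c P. hermitian_coeffs n m c \<and> signature n m c = (P, 1) \<and>
      squared_norm n (\<lambda>z. bihom n m c z * normsq n z) \<and> P < n"
    by (intro exI[of _ 2] exI[of _ "witness_coeff n"] exI[of _ "n - 1"])
      (simp add: witness_hermitian witness_signature witness_squared_norm)
qed

end
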